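(* Let $R\ge 0$ and let $V^{\mathrm{FB},\mathrm P}$ be the principal's first-best value $$V^{\mathrm{FB},\mathrm P}:=\sup\{J^{\mathrm P}(\mathbf C,\alpha):\ \mathbf C\in\mathbb C,\ \alpha\in\mathcal A,\ J^{\mathrm A}(\mathbf C,\alpha)\ge u(R)\}$$ (all objects as defined in the context, with $\delta=r/\rho$). Then: 1. If $\delta\gamma>1$, then $\underline v\le V^{\mathrm{FB},\mathrm P}\le\overline v$, where $$\underline v:=\inf_{\lambda\le 0}\Big\{\lambda u(R)-\sum_{i=1}^{N}e^{-\rho\tau_i}F^{*,k}(\lambda e^{(\rho-r)\tau_i})-e^{-\rho T}F^{*,0}(\lambda e^{(\rho-r)T})+\int_0^T\rho e^{-\rho t}G^*(\delta\lambda e^{(\rho-r)t})\,dt\Big\}$$ with $\tau_i=(i-1)\zeta$, $0<\zeta<\frac TN$, and $$\overline v:=\inf_{\lambda\le 0}\Big\{\lambda u(R)-N F^{*,k}(\lambda)-e^{-\rho T}F^{*,0}(\lambda e^{(\rho-r)T})+\int_0^T\rho e^{-\rho t}G^*(\delta\lambda e^{(\rho-r)t})\,dt\Big\}.$$ 2. If $\delta\gamma<1$, then $\underline v\le V^{\mathrm{FB},\mathrm P}\le\overline v$, where $$\underline v:=\inf_{\lambda\le 0}\Big\{\lambda u(R)-\sum_{i=1}^{N}e^{-\rho\tau_i}F^{*,k}(\lambda e^{(\rho-r)\tau_i})-e^{-\rho T}F^{*,0}(\lambda e^{(\rho-r)T})+\int_0^T\rho e^{-\rho t}G^*(\delta\lambda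 e^{(\rho-r)t})\,dt\Big\}$$ with $\tau_i=T-i\zeta$, $0<\zeta<\frac TN$, and $$\overline v:=\inf_{\lambda\le 0}\Big\{\lambda u(R)-N e^{-\rho T}F^{*,k}(\lambda e^{(\rho-r)T})-e^{-\rho T}F^{*,0}(\lambda e^{(\rho-r)T})+\int_0^T\rho e^{-\rho t}G^*(\delta\lambda e^{(\rho-r)t})\,dt\Big\}.$$ 3. If $\delta\gamma=1$, then $$V^{\mathrm{FB},\mathrm P}=\inf_{\lambda\le 0}\Big\{\lambda u(R)-N e^{-\rho T}F^{*,k}(\lambda e^{(\rho-r)T})-e^{-\rho T}F^{*,0}(\lambda e^{(\rho-r)T})+\int_0^T\rho e^{-\rho t}G^*(\delta\lambda e^{(\rho-r)t})\,dt\Big\}.$$ 4. If $R=0$, then $0<V^{\mathrm{FB},\mathrm P}<\bar a(1-e^{-\rho T})$.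
   Context: Parameters: horizon $T>0$, volatility $\sigma>0$, $X_0\in\mathbb R$, agent's discount rate $r>0$, principal's discount rate $\rho>0$, $\delta:=r/\rho$, transaction cost rate $k>0$, maximal effort $\bar a>0$, $A:=[0,\bar a]$, an integer $N\ge 1$ (number of bonus payments), and $\gamma>1$. The agent's utility is $u(\xi)=\xi^{1/\gamma}$ on $[0,\infty)$, with inverse $u^{-1}(y)=y^\gamma$. The cost of effort $h:[0,\infty)\to[0,\infty)$ is increasing, strictly convex, continuously differentiable, with $h(0)=0$. Probabilistic set-up: $(\Omega,\mathcal F,\mathbb P^0)$ carries a one-dimensional $\mathbb P^0$-Brownian motion $W^0$; $X_t=X_0+\sigma W^0_t$; $\mathbb F$ is the $\mathbb P^0$-augmented natural filtration of $X$. $\mathcal A$ is the set of $\mathbb F$-predictable $A$-valued processes. For $\alpha\in\mathcal A$, $\mathbb P^\alpha$ is the measure equivalent to $\mathbb P^0$ (given by Girsanov's theorem) under which $W^\alpha_t:=W^0_t-\int_0^t\frac{\alpha_s}{\sigma}\,ds$ is a Brownian motion (on $[0,T]$). Contracts: a contract is $\mathbf C=(\bar\tau_N,\bar\xi_N,\xi_T)$, where $\bar\tau_N=(\tau_1,\dots,\tau_N)$ are $\mathbb F$-stopping times with values in $[0,T)$ and $\tau_1\le\dots\le\tau_N$; $\bar\xi_N=(\xi_1,\dots,\xi_N)$ with $\xi_i$ a nonnegative $\mathcal F_{\tau_i}$-measurable random variable; $\xi_T$ is a nonnegative $\mathcal F_T$-measurable random variable. $\mathbb C$ is the set of contracts with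 $\max_{1\le i\le N}\sup_{\alpha\in\mathcal A}\big(\mathbb E^{\mathbb P^\alpha}[|\xi_i|^\gamma]+\mathbb E^{\mathbb P^\alpha}[|\xi_T|^\gamma]\big)<\infty$. Objectives: $$J^{\mathrm A}(\mathbf C,\alpha)=\mathbb E^{\mathbb P^\alpha}\Big[\sum_{i=1}^N e^{-r\tau_i}u(\xi_i)+e^{-rT}u(\xi_T)-\int_0^T re^{-rt}h(\alpha_t)\,dt\Big],$$ $$J^{\mathrm P}(\mathbf C,\alpha)=\mathbb E^{\mathbb P^\alpha}\Big[-\sum_{i=1}^N e^{-\rho\tau_i}(1+k)\xi_i-e^{-\rho T}\xi_T+\int_0^T\rho e^{-\rho t}\alpha_t\,dt\Big].$$ Dual functions: with $F(y):=-y^\gamma$, for $p\le 0$ and $\kappa\ge0$, $$G^*(p):=\sup_{a\in A}(a+h(a)p),\qquad F^{*,\kappa}(p):=\inf_{y\ge0}\big(yp-(1+\kappa)F(y)\big).$$ *)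

theory Defs
  imports "HOL-Probability.Probability"
begin

section \<open>Filtrations and Brownian motion\<close>

definition natural_filtration ::
  "'a set \<Rightarrow> (real \<Rightarrow> 'a \<Rightarrow> real) \<Rightarrow> real \<Rightarrow> 'a measure" where
  "natural_filtration \<Omega> X t =
     sigma \<Omega> {X s -` B \<inter> \<Omega> | s B. 0 \<le> s \<and> s \<le> t \<and> B \<in> sets borel}"

text \<open>The augmentation adds the null sets of the probability space, which need not be complete;
  when it is, these are the usual negligible sets. A filtration is indexed by all reals, as for
  \<^const>\<open>stopping_time\<close>. Processes are only prescribed on the interval from \<open>0\<close> to the horizon;
  what happens after the horizon does not matter, since stopping times are required to
  stay below it.\<close>

definition augmented_filtration ::
  "'a measure \<Rightarrow> (real \<Rightarrow> 'a \<Rightarrow> real) \<Rightarrow> real \<Rightarrow> 'a measure" where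
  "augmented_filtration M X t =
     sigma (space M) (sets (natural_filtration (space M) X t) \<union> null_sets M)"

text \<open>Standard Brownian motion on \<open>[0, T]\<close> relative to the filtration \<open>F\<close>. For the natural
  filtration of \<open>W\<close> this is the usual definition of a Brownian motion.\<close>

definition brownian_motion ::
  "'a measure \<Rightarrow> (real \<Rightarrow> 'a measure) \<Rightarrow> real \<Rightarrow> (real \<Rightarrow> 'a \<Rightarrow> real) \<Rightarrow> bool" where
  "brownian_motion M F T W \<longleftrightarrow>
     prob_space M \<and>
     (\<forall>t\<in>{0..T}. W t \<in> borel_measurable (F t)) \<and>
     (AE \<omega> in M. W 0 \<omega> = 0) \<and>
     (AE \<omega> in M. continuous_on {0..T} (\<lambda>t. W t \<omega>)) \<and>
     (\<forall>s t. 0 \<le> s \<and> s < t \<and> t \<le> T \<longrightarrow>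
        distributed M lborel (\<lambda>\<omega>. W t \<omega> - W s \<omega>) (\<lambda>x. ennreal (normal_density 0 (sqrt (t - s)) x)) \<and>
        prob_space.indep_set M (sets (F s))
          (sets (vimage_algebra (space M) (\<lambda>\<omega>. W t \<omega> - W s \<omega>) borel)))"

definition output_process ::
  "real \<Rightarrow> real \<Rightarrow> (real \<Rightarrow> 'a \<Rightarrow> real) \<Rightarrow> real \<Rightarrow> 'a \<Rightarrow> real" where
  "output_process X0 \<sigma> W t \<omega> = X0 + \<sigma> * W t \<omega>"

definition predictable_sigma ::
  "'a set \<Rightarrow> (real \<Rightarrow> 'a measure) \<Rightarrow> real \<Rightarrow> (real \<times> 'a) measure" where
  "predictable_sigma \<Omega> F T =
     sigma ({0..T} \<times> \<Omega>)
       ({{0} \<times> A | A. A \<in> sets (F 0)} \<union>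
        {{s<..t} \<times> A | s t A. 0 \<le> s \<and> s < t \<and> t \<le> T \<and> A \<in> sets (F s)})"


section \<open>Efforts and the associated measures\<close>

definition efforts ::
  "'a measure \<Rightarrow> (real \<Rightarrow> 'a measure) \<Rightarrow> real \<Rightarrow> real \<Rightarrow> (real \<Rightarrow> 'a \<Rightarrow> real) set" where
  "efforts M F T abar =
     {\<alpha>. (\<lambda>(t, \<omega>). \<alpha> t \<omega>) \<in> borel_measurable (predictable_sigma (space M) F T) \<and>
         (\<forall>t\<in>{0..T}. \<forall>\<omega>\<in>space M. \<alpha> t \<omega> \<in> {0..abar})}"

text \<open>The measures \<open>P\<^sup>\<alpha>\<close>: those equivalent to \<open>M\<close> under which the drift-corrected process is a
  Brownian motion for \<open>F\<close>. When \<open>F\<close> is the augmented filtration of \<open>W\<close>, Girsanov's theorem gives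
  such a measure for every effort \<open>\<alpha>\<close>, and by martingale representation any two of them agree on
  \<open>F T\<close>. The payoffs below are \<open>F T\<close>-measurable, so their expectations do not depend on which
  element of this set is taken as \<open>P\<^sup>\<alpha>\<close>.\<close>

definition girsanov_measures ::
  "'a measure \<Rightarrow> (real \<Rightarrow> 'a measure) \<Rightarrow> real \<Rightarrow> real \<Rightarrow> (real \<Rightarrow> 'a \<Rightarrow> real) \<Rightarrow>
   (real \<Rightarrow> 'a \<Rightarrow> real) \<Rightarrow> 'a measure set" where
  "girsanov_measures M F T \<sigma> W \<alpha> =
     {Q. sets Q = sets M \<and> absolutely_continuous M Q \<and> absolutely_continuous Q M \<and>
         brownian_motion Q F T (\<lambda>t \<omega>. W t \<omega> - (LINT s:{0..t}|lborel. \<alpha> s \<omega> / \<sigma>))}"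


section \<open>Contracts and objectives\<close>

record 'a contract =
  pay_time :: "nat \<Rightarrow> 'a \<Rightarrow> real"
  bonus :: "nat \<Rightarrow> 'a \<Rightarrow> real"
  final_pay :: "'a \<Rightarrow> real"

definition contracts ::
  "'a measure \<Rightarrow> (real \<Rightarrow> 'a \<Rightarrow> real) \<Rightarrow> real \<Rightarrow> real \<Rightarrow> real \<Rightarrow> real \<Rightarrow> nat \<Rightarrow> real \<Rightarrow> 'a contract set" where
  "contracts M W T \<sigma> X0 abar N \<gamma> =
     (let F = augmented_filtration M (output_process X0 \<sigma> W) in
      {C. (\<forall>i\<in>{1..N}. stopping_time F (pay_time C i) \<and>
             (\<forall>\<omega>\<in>space M. pay_time C i \<omega> \<in> {0..<T})) \<and>
          (\<forall>i\<in>{1..N}. \<forall>j\<in>{1..N}. i \<le> j \<longrightarrow>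
             (\<forall>\<omega>\<in>space M. pay_time C i \<omega> \<le> pay_time C j \<omega>)) \<and>
          (\<forall>i\<in>{1..N}. bonus C i \<in> borel_measurable
                         (filtration.pre_sigma (space M) F (pay_time C i)) \<and>
             (\<forall>\<omega>\<in>space M. 0 \<le> bonus C i \<omega>)) \<and>
          final_pay C \<in> borel_measurable (F T) \<and>
          (\<forall>\<omega>\<in>space M. 0 \<le> final_pay C \<omega>) \<and>
          (MAX i\<in>{1..N}. SUP \<alpha>\<in>efforts M F T abar. SUP Q\<in>girsanov_measures M F T \<sigma> W \<alpha>.
             (\<integral>\<^sup>+ \<omega>. ennreal (\<bar>bonus C i \<omega>\<bar> powr \<gamma>) \<partial>Q) +
             (\<integral>\<^sup>+ \<omega>. ennreal (\<bar>final_pay C \<omega>\<bar> powr \<gamma>) \<partial>Q)) < \<infinity>})"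

definition utility :: "real \<Rightarrow> real \<Rightarrow> real" where
  "utility \<gamma> \<xi> = \<xi> powr (1 / \<gamma>)"

definition agent_objective ::
  "real \<Rightarrow> real \<Rightarrow> nat \<Rightarrow> real \<Rightarrow> (real \<Rightarrow> real) \<Rightarrow>
   'a contract \<Rightarrow> (real \<Rightarrow> 'a \<Rightarrow> real) \<Rightarrow> 'a measure \<Rightarrow> real" where
  "agent_objective T r N \<gamma> h C \<alpha> Q =
     (LINT \<omega>|Q. (\<Sum>i=1..N. exp (- r * pay_time C i \<omega>) * utility \<gamma> (bonus C i \<omega>))
              + exp (- r * T) * utility \<gamma> (final_pay C \<omega>)
              - (LINT t:{0..T}|lborel. r * exp (- r * t) * h (\<alpha> t \<omega>)))"

definition principal_objective ::
  "real \<Rightarrow> real \<Rightarrow> real \<Rightarrow> nat \<Rightarrow>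
   'a contract \<Rightarrow> (real \<Rightarrow> 'a \<Rightarrow> real) \<Rightarrow> 'a measure \<Rightarrow> real" where
  "principal_objective T \<rho> k N C \<alpha> Q =
     (LINT \<omega>|Q. - (\<Sum>i=1..N. exp (- \<rho> * pay_time C i \<omega>) * (1 + k) * bonus C i \<omega>)
              - exp (- \<rho> * T) * final_pay C \<omega>
              + (LINT t:{0..T}|lborel. \<rho> * exp (- \<rho> * t) * \<alpha> t \<omega>))"

definition first_best_value ::
  "'a measure \<Rightarrow> (real \<Rightarrow> 'a \<Rightarrow> real) \<Rightarrow> real \<Rightarrow> real \<Rightarrow> real \<Rightarrow> real \<Rightarrow> real \<Rightarrow> real \<Rightarrow> real \<Rightarrow>
   nat \<Rightarrow> real \<Rightarrow> (real \<Rightarrow> real) \<Rightarrow> real \<Rightarrow> ereal" where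
  "first_best_value M W T \<sigma> X0 r \<rho> k abar N \<gamma> h R =
     (let F = augmented_filtration M (output_process X0 \<sigma> W) in
      Sup {ereal (principal_objective T \<rho> k N C \<alpha> Q) | C \<alpha> Q.
             C \<in> contracts M W T \<sigma> X0 abar N \<gamma> \<and>
             \<alpha> \<in> efforts M F T abar \<and>
             Q \<in> girsanov_measures M F T \<sigma> W \<alpha> \<and>
             utility \<gamma> R \<le> agent_objective T r N \<gamma> h C \<alpha> Q})"


section \<open>Dual functions\<close>

definition F_cost :: "real \<Rightarrow> real \<Rightarrow> real" where
  "F_cost \<gamma> y = - (y powr \<gamma>)"

text \<open>For \<open>p \<le> 0\<close> both real-valued extrema below are over bounded sets: \<open>h\<close> is bounded on
  \<open>[0, abar]\<close>, and \<open>y * p + (1 + \<kappa>) * y powr \<gamma>\<close> is bounded below because \<open>\<gamma> > 1\<close>.\<close>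

definition G_star :: "real \<Rightarrow> (real \<Rightarrow> real) \<Rightarrow> real \<Rightarrow> real" where
  "G_star abar h p = (SUP a\<in>{0..abar}. a + h a * p)"

definition F_star :: "real \<Rightarrow> real \<Rightarrow> real \<Rightarrow> real" where
  "F_star \<gamma> \<kappa> p = (INF y\<in>{0..}. y * p - (1 + \<kappa>) * F_cost \<gamma> y)"

end

theory Submission
  imports Defs
begin

text \<open>The upper bounds are Lagrangian weak duality: for a multiplier \<open>l \<le> 0\<close>, the payoff of a
  feasible contract is at most the pointwise maximum of the Lagrangian. The dual payment at date
  \<open>t\<close> contributes a multiple of \<open>exp ((\<rho> - r * \<gamma>) / (\<gamma> - 1) * t)\<close>, whose monotonicity in \<open>t\<close> is
  decided by comparing \<open>\<delta> * \<gamma>\<close> with \<open>1\<close>.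

  For the lower bounds the dates are fixed. Strict convexity makes the maximizers of the
  Lagrangian unique and continuous in \<open>l\<close>, so by the intermediate value theorem the agent's
  constraint binds for some \<open>l\<close>; the resulting contract is deterministic and has no duality gap.
  Its effort is continuous in time and is approximated from below by step functions, which only
  relaxes the agent's constraint. For step efforts the measure required by Girsanov's theorem is
  built explicitly, one constant drift on \<open>{u<..}\<close> at a time, with density
  \<open>exp (c * (W T - W u) - c\<^sup>2 * (T - u) / 2)\<close>.\<close>

section \<open>Gaussian increments\<close>

text \<open>The value is a supremum over triples of contract, effort and measure. The upper bound
  integrates an inequality valid for each outcome, so it holds whichever element of
  \<open>girsanov_measures\<close> the triple carries; only the lower bound has to exhibit one.
  There contract and effort are deterministic, both objectives integrate constants, and nothing
  about the measure matters except that it exists and has total mass one. Step efforts suffice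
  because a supremum tolerates a loss of \<epsilon>, and \<open>h\<close> is increasing.

  The exponent in the overview comes from homogeneity: \<open>F_star\<close> has degree
  \<open>\<gamma> / (\<gamma> - 1)\<close>, so the discount \<open>exp (- \<rho> * t)\<close> and
  the scaling of the multiplier by \<open>exp ((\<rho> - r) * t)\<close> merge into one exponential.
  As \<open>F_star\<close> is nonpositive, the dual bound is largest at date zero if
  \<open>\<delta> * \<gamma> > 1\<close> and at \<open>T\<close> if
  \<open>\<delta> * \<gamma> < 1\<close>; with equality all dates give the same dual value and the
  two bounds meet.\<close>

definition gaussian_increment :: "'a measure \<Rightarrow> 'a measure \<Rightarrow> real \<Rightarrow> ('a \<Rightarrow> real) \<Rightarrow> bool" where
  "gaussian_increment M G v D \<longleftrightarrow> D \<in> borel_measurable M \<and>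
     (\<forall>g \<in> borel_measurable (G \<Otimes>\<^sub>M borel). (\<integral>\<^sup>+\<omega>. g (\<omega>, D \<omega>) \<partial>M) =
        (\<integral>\<^sup>+\<omega>. (\<integral>\<^sup>+y. g (\<omega>, y) * ennreal (normal_density 0 (sqrt v) y) \<partial>lborel) \<partial>M))"

lemma measurable_from_sub:
  assumes "space G = space M" "sets G \<subseteq> sets M" "f \<in> G \<rightarrow>\<^sub>M N"
  shows "f \<in> M \<rightarrow>\<^sub>M N"
  using assms unfolding measurable_def by auto

lemma measurable_ident_sub:
  assumes "space G = space M" "sets G \<subseteq> sets M"
  shows "(\<lambda>x. x) \<in> M \<rightarrow>\<^sub>M G"
  by (rule measurable_from_sub[OF assms measurable_ident_sets[OF refl]])

text \<open>Independence makes the joint law of the identity into \<open>G\<close> and of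
  \<open>D\<close> a product measure; Fubini and the normal density do the rest. The integral form
  packs law and independence into one rule in which \<open>g\<close> may depend on the past, so that
  density factors can later be absorbed into \<open>g\<close>.\<close>

lemma gaussian_incrementI:
  assumes M: "prob_space M" and G: "space G = space M" "sets G \<subseteq> sets M"
    and D: "distributed M lborel D (\<lambda>x. ennreal (normal_density 0 (sqrt v) x))"
    and ind: "prob_space.indep_set M (sets G) (sets (vimage_algebra (space M) D borel))"
  shows "gaussian_increment M G v D"
proof -
  interpret prob_space M by fact
  have Dm[measurable]: "D \<in> borel_measurable M"
    using D by (simp add: distributed_def)
  have id[measurable]: "(\<lambda>x. x) \<in> M \<rightarrow>\<^sub>M G"
    using G by (rule measurable_ident_sub)
  have dD: "distr M borel D = density lborel (\<lambda>x. ennreal (normal_density 0 (sqrt v) x))"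
    using D by (simp add: distributed_def cong: distr_cong)
  interpret D: prob_space "distr M borel D" by (rule prob_space_distr) simp
  interpret G: prob_space "distr M G (\<lambda>x. x)" by (rule prob_space_distr) simp
  have eq: "distr M G (\<lambda>x. x) \<Otimes>\<^sub>M distr M borel D = distr M (G \<Otimes>\<^sub>M borel) (\<lambda>x. (x, D x))"
  proof (rule pair_measure_eqI)
    fix A B assume "A \<in> sets (distr M G (\<lambda>x. x))" "B \<in> sets (distr M borel D)"
    then have [measurable]: "A \<in> sets G" "B \<in> sets borel" by auto
    have A: "A \<inter> space M = A"
      using sets.Int_space_eq2[OF \<open>A \<in> sets G\<close>] G(1) by simp
    have "prob (A \<inter> (D -` B \<inter> space M)) = prob A * prob (D -` B \<inter> space M)"
      by (rule indep_setD[OF ind]) (auto simp: sets_vimage_algebra2)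
    moreover have "(\<lambda>x. (x, D x)) -` (A \<times> B) \<inter> space M = A \<inter> (D -` B \<inter> space M)"
      using A by auto
    ultimately show "emeasure (distr M G (\<lambda>x. x)) A * emeasure (distr M borel D) B =
        emeasure (distr M (G \<Otimes>\<^sub>M borel) (\<lambda>x. (x, D x))) (A \<times> B)"
      by (simp add: emeasure_distr A emeasure_eq_measure ennreal_mult)
  qed (simp_all add: G.sigma_finite_measure_axioms D.sigma_finite_measure_axioms cong: sets_pair_measure_cong)
  show ?thesis unfolding gaussian_increment_def
  proof (intro conjI ballI Dm)
    fix g :: "'a \<times> real \<Rightarrow> ennreal" assume g[measurable]: "g \<in> borel_measurable (G \<Otimes>\<^sub>M borel)"
    have gn: "g \<in> borel_measurable (distr M G (\<lambda>x. x) \<Otimes>\<^sub>M distr M borel D)" by simp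
    have "(\<integral>\<^sup>+\<omega>. g (\<omega>, D \<omega>) \<partial>M) = (\<integral>\<^sup>+z. g z \<partial>(distr M (G \<Otimes>\<^sub>M borel) (\<lambda>x. (x, D x))))"
      by (subst nn_integral_distr) simp_all
    also have "\<dots> = (\<integral>\<^sup>+x. \<integral>\<^sup>+y. g (x, y) \<partial>distr M borel D \<partial>distr M G (\<lambda>x. x))"
      unfolding eq[symmetric] by (rule D.nn_integral_fst[symmetric, OF gn])
    also have "\<dots> = (\<integral>\<^sup>+x. \<integral>\<^sup>+y. g (x, y) \<partial>distr M borel D \<partial>M)"
      by (subst nn_integral_distr) (auto intro!: D.borel_measurable_nn_integral)
    also have "\<dots> = (\<integral>\<^sup>+x. \<integral>\<^sup>+y. g (x, y) * ennreal (normal_density 0 (sqrt v) y) \<partial>lborel \<partial>M)"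
    proof (rule nn_integral_cong)
      fix x assume "x \<in> space M"
      then have x: "x \<in> space G" using G by simp
      then show "(\<integral>\<^sup>+y. g (x, y) \<partial>distr M borel D) = (\<integral>\<^sup>+y. g (x, y) * ennreal (normal_density 0 (sqrt v) y) \<partial>lborel)"
        unfolding dD by (subst nn_integral_density) (auto simp: mult.commute)
    qed
    finally show "(\<integral>\<^sup>+\<omega>. g (\<omega>, D \<omega>) \<partial>M) = (\<integral>\<^sup>+x. \<integral>\<^sup>+y. g (x, y) * ennreal (normal_density 0 (sqrt v) y) \<partial>lborel \<partial>M)" .
  qed
qed

lemma gaussian_increment_measurable: "gaussian_increment M G v D \<Longrightarrow> D \<in> borel_measurable M"
  by (simp add: gaussian_increment_def)

lemma gaussian_incrementD:
  assumes "gaussian_increment M G v D" "g \<in> borel_measurable (G \<Otimes>\<^sub>M borel)"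
  shows "(\<integral>\<^sup>+\<omega>. g (\<omega>, D \<omega>) \<partial>M) =
     (\<integral>\<^sup>+\<omega>. (\<integral>\<^sup>+y. g (\<omega>, y) * ennreal (normal_density 0 (sqrt v) y) \<partial>lborel) \<partial>M)"
  using assms by (simp add: gaussian_increment_def)

text \<open>Testing with indicators of rectangles returns to the form in which
  \<open>brownian_motion\<close> is stated; the whole space as past event gives the law.\<close>

lemma gaussian_increment_imp_indep:
  assumes M: "prob_space M" and G: "space G = space M" "sets G \<subseteq> sets M"
    and D: "gaussian_increment M G v D"
  shows "distributed M lborel D (\<lambda>x. ennreal (normal_density 0 (sqrt v) x))"
    and "prob_space.indep_set M (sets G) (sets (vimage_algebra (space M) D borel))"
proof -
  interpret prob_space M by fact
  have Dm[measurable]: "D \<in> borel_measurable M"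
    using D by (rule gaussian_increment_measurable)
  let ?n = "density lborel (\<lambda>x. ennreal (normal_density 0 (sqrt v) x))"
  have key: "emeasure M (A \<inter> (D -` B \<inter> space M)) = emeasure M A * emeasure ?n B"
    if A[measurable]: "A \<in> sets G" and B[measurable]: "B \<in> sets borel" for A B
  proof -
    have [measurable]: "A \<in> sets M" using A G by auto
    have "emeasure M (A \<inter> (D -` B \<inter> space M)) = (\<integral>\<^sup>+\<omega>. indicator A \<omega> * indicator B (D \<omega>) \<partial>M)"
    proof -
      have "(\<integral>\<^sup>+\<omega>. indicator A \<omega> * indicator B (D \<omega>) \<partial>M) = (\<integral>\<^sup>+\<omega>. indicator (A \<inter> (D -` B \<inter> space M)) \<omega> \<partial>M)"
        by (intro nn_integral_cong) (simp split: split_indicator)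
      then show ?thesis by simp
    qed
    also have "\<dots> = (\<integral>\<^sup>+\<omega>. (\<integral>\<^sup>+y. indicator A \<omega> * indicator B y * ennreal (normal_density 0 (sqrt v) y) \<partial>lborel) \<partial>M)"
      using gaussian_incrementD[OF D, of "\<lambda>(\<omega>, y). indicator A \<omega> * indicator B y"] by simp
    also have "\<dots> = (\<integral>\<^sup>+\<omega>. indicator A \<omega> * emeasure ?n B \<partial>M)"
      by (intro nn_integral_cong) (simp add: emeasure_density nn_integral_cmult mult.assoc, simp add: mult.commute)
    also have "\<dots> = emeasure M A * emeasure ?n B"
      by (simp add: nn_integral_multc)
    finally show ?thesis .
  qed
  have dist: "emeasure M (D -` B \<inter> space M) = emeasure ?n B" if B: "B \<in> sets borel" for B
    using key[of "space M" B] B G(1) sets.top[of G] emeasure_space_1 by (simp add: Int_absorb1)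
  show "distributed M lborel D (\<lambda>x. ennreal (normal_density 0 (sqrt v) x))"
    unfolding distributed_def
    by (auto intro!: measure_eqI simp: emeasure_distr dist)
  show "indep_set (sets G) (sets (vimage_algebra (space M) D borel))"
    unfolding indep_sets2_eq
  proof (intro conjI ballI G)
    show "sets (vimage_algebra (space M) D borel) \<subseteq> events"
      by (auto simp: sets_vimage_algebra2)
    fix a b assume a: "a \<in> sets G" and b: "b \<in> sets (vimage_algebra (space M) D borel)"
    then obtain B where B: "B \<in> sets borel" "b = D -` B \<inter> space M"
      by (auto simp: sets_vimage_algebra2)
    have "emeasure M (a \<inter> b) = emeasure M a * emeasure M b"
      unfolding B(2) key[OF a B(1)] dist[OF B(1)] ..
    then show "prob (a \<inter> b) = prob a * prob b"
      by (simp add: measure_def enn2real_mult)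
  qed
qed

text \<open>Integrating out \<open>D2\<close> given \<open>H\<close>, then \<open>D1\<close> given
  \<open>G\<close>, leaves a convolution of two centred normal laws. This serves for increments that
  straddle the time at which a drift is switched on.\<close>

lemma gaussian_increment_add:
  assumes M: "sigma_finite_measure M" and G: "space G = space M" "sets G \<subseteq> sets H"
    and H: "space H = space M" "sets H \<subseteq> sets M"
    and D1: "gaussian_increment M G v1 D1" "D1 \<in> borel_measurable H"
    and D2: "gaussian_increment M H v2 D2" and v: "0 < v1" "0 < v2"
  shows "gaussian_increment M G (v1 + v2) (\<lambda>\<omega>. D1 \<omega> + D2 \<omega>)"
  unfolding gaussian_increment_def
proof (intro conjI ballI)
  show "(\<lambda>\<omega>. D1 \<omega> + D2 \<omega>) \<in> borel_measurable M"
    using D1(1) D2 by (auto dest!: gaussian_increment_measurable)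
  fix g :: "'a \<times> real \<Rightarrow> ennreal" assume g[measurable]: "g \<in> borel_measurable (G \<Otimes>\<^sub>M borel)"
  note [measurable] = D1(2)
  have id[measurable]: "(\<lambda>x. x) \<in> H \<rightarrow>\<^sub>M G"
    using G H by (auto intro: measurable_ident_sub)
  let ?n = "\<lambda>v y. ennreal (normal_density 0 (sqrt v) y)"
  have "(\<integral>\<^sup>+\<omega>. g (\<omega>, D1 \<omega> + D2 \<omega>) \<partial>M) = (\<integral>\<^sup>+\<omega>. (\<integral>\<^sup>+y. g (\<omega>, D1 \<omega> + y) * ?n v2 y \<partial>lborel) \<partial>M)"
    using gaussian_incrementD[OF D2, of "\<lambda>(\<omega>, y). g (\<omega>, D1 \<omega> + y)"] by simp
  also have "\<dots> = (\<integral>\<^sup>+\<omega>. \<integral>\<^sup>+x. (\<integral>\<^sup>+y. g (\<omega>, x + y) * ?n v2 y \<partial>lborel) * ?n v1 x \<partial>lborel \<partial>M)"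
    using gaussian_incrementD[OF D1(1), of "\<lambda>(\<omega>, x). (\<integral>\<^sup>+y. g (\<omega>, x + y) * ?n v2 y \<partial>lborel)"] by simp
  also have "\<dots> = (\<integral>\<^sup>+\<omega>. \<integral>\<^sup>+z. g (\<omega>, z) * ?n (v1 + v2) z \<partial>lborel \<partial>M)"
  proof (rule nn_integral_cong)
    fix \<omega> assume "\<omega> \<in> space M"
    then have \<omega>[simp]: "\<omega> \<in> space G" using G by simp
    have [measurable]: "(\<lambda>y. g (\<omega>, y)) \<in> borel_measurable borel" by simp
    have "(\<integral>\<^sup>+x. (\<integral>\<^sup>+y. g (\<omega>, x + y) * ?n v2 y \<partial>lborel) * ?n v1 x \<partial>lborel) =
        (\<integral>\<^sup>+x. (\<integral>\<^sup>+y. g (\<omega>, y) * (?n v2 (y - x) * ?n v1 x) \<partial>lborel) \<partial>lborel)"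
    proof (rule nn_integral_cong)
      fix x :: real
      have "(\<integral>\<^sup>+y. g (\<omega>, x + y) * ?n v2 y \<partial>lborel) = (\<integral>\<^sup>+y. g (\<omega>, y) * ?n v2 (y - x) \<partial>lborel)"
        by (subst (2) nn_integral_real_affine[where c=1 and t=x]) auto
      then show "(\<integral>\<^sup>+y. g (\<omega>, x + y) * ?n v2 y \<partial>lborel) * ?n v1 x = (\<integral>\<^sup>+y. g (\<omega>, y) * (?n v2 (y - x) * ?n v1 x) \<partial>lborel)"
        by (simp add: nn_integral_multc[symmetric] mult.assoc)
    qed
    also have "\<dots> = (\<integral>\<^sup>+y. (\<integral>\<^sup>+x. g (\<omega>, y) * (?n v2 (y - x) * ?n v1 x) \<partial>lborel) \<partial>lborel)"
      by (rule lborel_pair.Fubini') measurable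
    also have "\<dots> = (\<integral>\<^sup>+y. g (\<omega>, y) * ?n (v1 + v2) y \<partial>lborel)"
    proof (rule nn_integral_cong)
      fix y :: real
      have "(\<integral>\<^sup>+x. ?n v2 (y - x) * ?n v1 x \<partial>lborel) = ?n (v1 + v2) y"
        using fun_cong[OF conv_normal_density_zero_mean[of "sqrt v2" "sqrt v1"], of y] v
        by (simp add: ennreal_mult' add.commute)
      then show "(\<integral>\<^sup>+x. g (\<omega>, y) * (?n v2 (y - x) * ?n v1 x) \<partial>lborel) = g (\<omega>, y) * ?n (v1 + v2) y"
        by (simp add: nn_integral_cmult)
    qed
    finally show "(\<integral>\<^sup>+x. (\<integral>\<^sup>+y. g (\<omega>, x + y) * ?n v2 y \<partial>lborel) * ?n v1 x \<partial>lborel) = \<dots>" .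
  qed
  finally show "(\<integral>\<^sup>+\<omega>. g (\<omega>, D1 \<omega> + D2 \<omega>) \<partial>M) = \<dots>" .
qed

text \<open>Completing the square: an exponential tilt of a centred normal law only moves its mean,
  by \<open>c * v\<close>. This is the one-dimensional core of Girsanov's theorem.\<close>

lemma normal_density_shift:
  assumes "0 < v"
  shows "exp (c * y - c\<^sup>2 * v / 2) * normal_density 0 (sqrt v) y = normal_density 0 (sqrt v) (y - c * v)"
proof -
  have "c * y - c\<^sup>2 * v / 2 - y\<^sup>2 / (2 * v) = - ((y - c * v)\<^sup>2 / (2 * v))"
    using assms by (simp add: field_simps power2_eq_square)
  then show ?thesis
    using assms by (simp add: normal_density_def exp_add[symmetric] exp_diff divide_simps exp_minus mult_ac)
      (simp add: exp_add[symmetric] exp_diff[symmetric] exp_minus[symmetric] field_simps)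
qed

section \<open>Change of measure for a step drift\<close>

lemma brownian_motion_gaussian_increment:
  assumes W: "brownian_motion M F T W" and "0 \<le> s" "s < t" "t \<le> T"
    and F: "space (F s) = space M"
  shows "sets (F s) \<subseteq> sets M" "gaussian_increment M (F s) (t - s) (\<lambda>\<omega>. W t \<omega> - W s \<omega>)"
proof -
  have M: "prob_space M" and D: "distributed M lborel (\<lambda>\<omega>. W t \<omega> - W s \<omega>) (\<lambda>x. ennreal (normal_density 0 (sqrt (t - s)) x))"
    and ind: "prob_space.indep_set M (sets (F s))
          (sets (vimage_algebra (space M) (\<lambda>\<omega>. W t \<omega> - W s \<omega>) borel))"
    using assms unfolding brownian_motion_def by auto
  interpret prob_space M by fact
  \<comment> \<open>Independent families consist of events by definition, which places each
    \<open>F s\<close> with \<open>s < T\<close> inside \<open>M\<close>. Nothing follows for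
    \<open>F T\<close>, since no increment starts at the horizon.\<close>
  show sub: "sets (F s) \<subseteq> sets M"
    using ind unfolding indep_sets2_eq by auto
  show "gaussian_increment M (F s) (t - s) (\<lambda>\<omega>. W t \<omega> - W s \<omega>)"
    by (rule gaussian_incrementI[OF M F sub D ind])
qed

text \<open>The tilted density is the shifted one, so under the weight the increment minus its drift
  \<open>c * v\<close> behaves, given \<open>G\<close>, like the unweighted increment.\<close>

lemma nn_integral_exponential_increment:
  assumes D: "gaussian_increment M G v D" and v: "0 < v"
    and g: "g \<in> borel_measurable (G \<Otimes>\<^sub>M borel)" and G: "space G = space M"
  shows "(\<integral>\<^sup>+\<omega>. ennreal (exp (c * D \<omega> - c\<^sup>2 * v / 2)) * g (\<omega>, D \<omega> - c * v) \<partial>M) =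
     (\<integral>\<^sup>+\<omega>. (\<integral>\<^sup>+y. g (\<omega>, y) * ennreal (normal_density 0 (sqrt v) y) \<partial>lborel) \<partial>M)"
proof -
  note [measurable] = g
  let ?n = "\<lambda>y. ennreal (normal_density 0 (sqrt v) y)"
  have "(\<integral>\<^sup>+\<omega>. ennreal (exp (c * D \<omega> - c\<^sup>2 * v / 2)) * g (\<omega>, D \<omega> - c * v) \<partial>M) =
     (\<integral>\<^sup>+\<omega>. (\<integral>\<^sup>+y. ennreal (exp (c * y - c\<^sup>2 * v / 2)) * g (\<omega>, y - c * v) * ?n y \<partial>lborel) \<partial>M)"
    using gaussian_incrementD[OF D, of "\<lambda>(\<omega>, y). ennreal (exp (c * y - c\<^sup>2 * v / 2)) * g (\<omega>, y - c * v)"] by simp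
  also have "\<dots> = (\<integral>\<^sup>+\<omega>. (\<integral>\<^sup>+y. g (\<omega>, y) * ?n y \<partial>lborel) \<partial>M)"
  proof (rule nn_integral_cong)
    fix \<omega> assume "\<omega> \<in> space M"
    then have \<omega>[simp]: "\<omega> \<in> space G" using G by simp
    have "(\<integral>\<^sup>+y. ennreal (exp (c * y - c\<^sup>2 * v / 2)) * g (\<omega>, y - c * v) * ?n y \<partial>lborel) =
       (\<integral>\<^sup>+y. g (\<omega>, y - c * v) * ?n (y - c * v) \<partial>lborel)"
      by (intro nn_integral_cong)
        (simp add: normal_density_shift[OF v, symmetric] ennreal_mult mult_ac)
    also have "\<dots> = (\<integral>\<^sup>+y. g (\<omega>, y) * ?n y \<partial>lborel)"
      by (subst nn_integral_real_affine[where c=1 and t="c * v"]) auto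
    finally show "(\<integral>\<^sup>+y. ennreal (exp (c * y - c\<^sup>2 * v / 2)) * g (\<omega>, y - c * v) * ?n y \<partial>lborel) = \<dots>" .
  qed
  finally show ?thesis .
qed

text \<open>The case of a test function that ignores the increment: the weight has conditional mean
  one given \<open>G\<close>.\<close>

lemma nn_integral_exponential_martingale:
  assumes D: "gaussian_increment M G v D" and v: "0 < v"
    and g[measurable]: "g \<in> borel_measurable G" and G: "space G = space M"
  shows "(\<integral>\<^sup>+\<omega>. ennreal (exp (c * D \<omega> - c\<^sup>2 * v / 2)) * g \<omega> \<partial>M) = (\<integral>\<^sup>+\<omega>. g \<omega> \<partial>M)"
proof -
  have 1: "(\<integral>\<^sup>+y. ennreal (normal_density 0 (sqrt v) y) \<partial>lborel) = 1"
    using prob_space.emeasure_space_1[OF prob_space_normal_density[of "sqrt v" 0]] v by (simp add: emeasure_density)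
  show ?thesis
    using nn_integral_exponential_increment[OF D v _ G, of "\<lambda>(\<omega>, y). g \<omega>" c]
    by (simp add: nn_integral_cmult 1)
qed

text \<open>The density \<open>E u T\<close> leaves the time before \<open>u\<close> untouched and
  tilts the time after it. \<open>F\<close> is an arbitrary filtration rather than the one generated
  by \<open>W\<close>, so that the result can be applied again to the corrected process under the
  new measure.\<close>

lemma girsanov_constant_drift:
  fixes W :: "real \<Rightarrow> 'a \<Rightarrow> real" and c u T :: real
  defines "W' \<equiv> (\<lambda>t \<omega>. W t \<omega> - c * max 0 (t - u))"
  assumes W: "brownian_motion M F T W" and F: "filtration (space M) F" "sets (F T) \<subseteq> sets M"
    and u: "0 \<le> u" "u < T"
  shows "\<exists>Q. sets Q = sets M \<and> absolutely_continuous M Q \<and> absolutely_continuous Q M \<and> brownian_motion Q F T W'"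
proof -
  interpret prob_space M using W by (simp add: brownian_motion_def)
  interpret filtration "space M" F by fact
  have sub: "sets (F s) \<subseteq> sets M" if "s \<le> T" for s
    using sets_F_mono[OF that] F(2) by auto
  have WF: "W s \<in> borel_measurable (F s)" if "0 \<le> s" "s \<le> T" for s
    using W that by (simp add: brownian_motion_def)
  have WFt: "W s \<in> borel_measurable (F t)" if "0 \<le> s" "s \<le> t" "t \<le> T" for s t
    by (rule measurable_from_sub[OF _ _ WF[of s]]) (use that sets_F_mono in \<open>auto simp: space_F\<close>)
  have WM: "W s \<in> borel_measurable M" if "0 \<le> s" "s \<le> T" for s
    by (rule measurable_from_sub[OF _ _ WF[OF that]]) (use that sub in \<open>auto simp: space_F\<close>)
  have [measurable]: "W T \<in> borel_measurable M" "W u \<in> borel_measurable M"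
    using WM u by auto
  note inc = brownian_motion_gaussian_increment(2)[OF W _ _ _ space_F]
  \<comment> \<open>The likelihood ratio accumulated between \<open>s\<close> and \<open>t\<close>;
    ratios over adjacent intervals multiply.\<close>
  define E where "E s t \<omega> = ennreal (exp (c * (W t \<omega> - W s \<omega>) - c\<^sup>2 * (t - s) / 2))" for s t \<omega>
  have E_mult: "E s t \<omega> * E t v \<omega> = E s v \<omega>" for s t v \<omega>
    unfolding E_def by (simp add: ennreal_mult[symmetric] exp_add[symmetric]) (simp add: field_simps)
  have E_meas: "E s t \<in> borel_measurable (F v)" if "0 \<le> s" "s \<le> t" "t \<le> v" "v \<le> T" for s t v
  proof -
    have [measurable]: "W s \<in> borel_measurable (F v)" "W t \<in> borel_measurable (F v)"
      using that by (auto intro!: WFt)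
    show ?thesis unfolding E_def by measurable
  qed
  have [measurable]: "E u T \<in> borel_measurable M"
    unfolding E_def by measurable
  define Q where "Q = density M (E u T)"
  have sQ[simp]: "sets Q = sets M" "space Q = space M" by (auto simp: Q_def)
  \<comment> \<open>Against an \<open>F s\<close>-measurable function the factor for the time after
    \<open>s\<close> averages to one; at the horizon no increment is left and the factor is
    constantly one.\<close>
  have drop: "(\<integral>\<^sup>+\<omega>. E s T \<omega> * g \<omega> \<partial>M) = (\<integral>\<^sup>+\<omega>. g \<omega> \<partial>M)"
    if "0 \<le> s" "s \<le> T" "g \<in> borel_measurable (F s)" for s g
  proof (cases "s = T")
    case True then show ?thesis by (simp add: E_def)
  next
    case False
    then show ?thesis
      using nn_integral_exponential_martingale[OF inc[of s T] _ that(3) space_F, of c] that by (simp add: E_def)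
  qed
  \<comment> \<open>Restricted to \<open>F s\<close>, the density of \<open>Q\<close> is the factor
    accumulated from \<open>u\<close> to \<open>s\<close>.\<close>
  have Q: "(\<integral>\<^sup>+\<omega>. g \<omega> \<partial>Q) = (\<integral>\<^sup>+\<omega>. E u s \<omega> * g \<omega> \<partial>M)"
    if s: "u \<le> s" "s \<le> T" and g[measurable]: "g \<in> borel_measurable (F s)" for s g
  proof -
    have [measurable]: "g \<in> borel_measurable M" "E u s \<in> borel_measurable (F s)"
      using measurable_from_sub[OF _ sub g] s E_meas u by (auto simp: space_F)
    have "(\<integral>\<^sup>+\<omega>. g \<omega> \<partial>Q) = (\<integral>\<^sup>+\<omega>. E u T \<omega> * g \<omega> \<partial>M)"
      unfolding Q_def by (rule nn_integral_density) auto
    also have "\<dots> = (\<integral>\<^sup>+\<omega>. E s T \<omega> * (E u s \<omega> * g \<omega>) \<partial>M)"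
      by (simp add: E_mult[of u s _ T, symmetric] mult_ac)
    also have "\<dots> = (\<integral>\<^sup>+\<omega>. E u s \<omega> * g \<omega> \<partial>M)"
      using s u by (intro drop) auto
    finally show ?thesis .
  qed
  \<comment> \<open>At time \<open>u\<close> no factor has accumulated yet, so \<open>Q\<close> and
    \<open>M\<close> agree on \<open>F u\<close> and everything earlier.\<close>
  have Qu: "(\<integral>\<^sup>+\<omega>. g \<omega> \<partial>Q) = (\<integral>\<^sup>+\<omega>. g \<omega> \<partial>M)" if "s \<le> u" "g \<in> borel_measurable (F s)" for s g
    using Q[of u g] measurable_from_sub[OF _ sets_F_mono[OF that(1)] that(2)] u by (simp add: E_def space_F)
  have W'M: "W' s \<in> borel_measurable M" if "0 \<le> s" "s \<le> T" for s
    unfolding W'_def by (intro borel_measurable_diff WM that) simp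
  have W'F: "W' s \<in> borel_measurable (F t)" if "0 \<le> s" "s \<le> t" "t \<le> T" for s t
    unfolding W'_def by (intro borel_measurable_diff WFt that) simp
  have pQ: "prob_space Q"
  proof
    have "emeasure Q (space Q) = (\<integral>\<^sup>+\<omega>. 1 \<partial>Q)" by simp
    also have "\<dots> = (\<integral>\<^sup>+\<omega>. 1 \<partial>M)"
      by (rule Qu[of u]) auto
    finally show "emeasure Q (space Q) = 1" by (simp add: emeasure_space_1)
  qed
  have nn_conv: "(\<lambda>\<omega>. \<integral>\<^sup>+y. g (\<omega>, y) * ennreal (normal_density 0 (sqrt v) y) \<partial>lborel) \<in> borel_measurable G"
    if [measurable]: "g \<in> borel_measurable (G \<Otimes>\<^sub>M borel)" for g v and G :: "'a measure"
    by measurable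
  have before: "gaussian_increment Q (F s) (t - s) (\<lambda>\<omega>. W' t \<omega> - W' s \<omega>)"
    if st: "0 \<le> s" "s < t" "t \<le> u" for s t
    unfolding gaussian_increment_def
  proof (intro conjI ballI)
    show "(\<lambda>\<omega>. W' t \<omega> - W' s \<omega>) \<in> borel_measurable Q"
      using W'M[of s] W'M[of t] st u by (auto simp: measurable_cong_sets[OF sQ(1) refl])
    fix g :: "'a \<times> real \<Rightarrow> ennreal" assume g[measurable]: "g \<in> borel_measurable (F s \<Otimes>\<^sub>M borel)"
    have D: "W' t \<omega> - W' s \<omega> = W t \<omega> - W s \<omega>" for \<omega>
      using st by (simp add: W'_def)
    have [measurable]: "W s \<in> borel_measurable (F t)" "W t \<in> borel_measurable (F t)"
      "(\<lambda>\<omega>. \<omega>) \<in> F t \<rightarrow>\<^sub>M F s"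
      using st u sets_F_mono[of s t] by (auto intro!: WFt measurable_ident_sub simp: space_F)
    have "(\<integral>\<^sup>+\<omega>. g (\<omega>, W' t \<omega> - W' s \<omega>) \<partial>Q) = (\<integral>\<^sup>+\<omega>. g (\<omega>, W t \<omega> - W s \<omega>) \<partial>M)"
      unfolding D using st by (intro Qu[of t]) auto
    also have "\<dots> = (\<integral>\<^sup>+\<omega>. (\<integral>\<^sup>+y. g (\<omega>, y) * ennreal (normal_density 0 (sqrt (t - s)) y) \<partial>lborel) \<partial>M)"
      using st u by (intro gaussian_incrementD[OF inc]) auto
    also have "\<dots> = (\<integral>\<^sup>+\<omega>. (\<integral>\<^sup>+y. g (\<omega>, y) * ennreal (normal_density 0 (sqrt (t - s)) y) \<partial>lborel) \<partial>Q)"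
      using st by (intro Qu[of s, symmetric] nn_conv g) auto
    finally show "(\<integral>\<^sup>+\<omega>. g (\<omega>, W' t \<omega> - W' s \<omega>) \<partial>Q) = \<dots>" .
  qed
  have after: "gaussian_increment Q (F s) (t - s) (\<lambda>\<omega>. W' t \<omega> - W' s \<omega>)"
    if st: "u \<le> s" "s < t" "t \<le> T" for s t
    unfolding gaussian_increment_def
  proof (intro conjI ballI)
    show "(\<lambda>\<omega>. W' t \<omega> - W' s \<omega>) \<in> borel_measurable Q"
      using W'M[of s] W'M[of t] st u by (auto simp: measurable_cong_sets[OF sQ(1) refl])
    fix g :: "'a \<times> real \<Rightarrow> ennreal" assume g[measurable]: "g \<in> borel_measurable (F s \<Otimes>\<^sub>M borel)"
    have D: "W' t \<omega> - W' s \<omega> = (W t \<omega> - W s \<omega>) - c * (t - s)" for \<omega>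
      using st by (simp add: W'_def algebra_simps)
    have [measurable]: "W s \<in> borel_measurable (F t)" "W t \<in> borel_measurable (F t)"
      "(\<lambda>\<omega>. \<omega>) \<in> F t \<rightarrow>\<^sub>M F s"
      using st u sets_F_mono[of s t] by (auto intro!: WFt measurable_ident_sub simp: space_F)
    have [measurable]: "E u s \<in> borel_measurable (F s)" using st u E_meas by auto
    have "(\<integral>\<^sup>+\<omega>. g (\<omega>, W' t \<omega> - W' s \<omega>) \<partial>Q) = (\<integral>\<^sup>+\<omega>. E u t \<omega> * g (\<omega>, (W t \<omega> - W s \<omega>) - c * (t - s)) \<partial>M)"
      unfolding D using st by (intro Q) auto
    \<comment> \<open>The factor up to \<open>s\<close> belongs to the past and joins
      \<open>g\<close>; only the factor from \<open>s\<close> to \<open>t\<close> shifts the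
      increment.\<close>
    also have "\<dots> = (\<integral>\<^sup>+\<omega>. E s t \<omega> * (E u s \<omega> * g (\<omega>, (W t \<omega> - W s \<omega>) - c * (t - s))) \<partial>M)"
      by (simp add: E_mult[of u s _ t, symmetric] mult_ac)
    also have "\<dots> = (\<integral>\<^sup>+\<omega>. (\<integral>\<^sup>+y. E u s \<omega> * g (\<omega>, y) * ennreal (normal_density 0 (sqrt (t - s)) y) \<partial>lborel) \<partial>M)"
    proof -
      have "(\<lambda>(\<omega>, y). E u s \<omega> * g (\<omega>, y)) \<in> borel_measurable (F s \<Otimes>\<^sub>M borel)" by measurable
      then show ?thesis
        using st u nn_integral_exponential_increment[OF inc[of s t] _ _ space_F, of "\<lambda>(\<omega>, y). E u s \<omega> * g (\<omega>, y)" c]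
        by (simp add: E_def[of s t])
    qed
    also have "\<dots> = (\<integral>\<^sup>+\<omega>. E u s \<omega> * (\<integral>\<^sup>+y. g (\<omega>, y) * ennreal (normal_density 0 (sqrt (t - s)) y) \<partial>lborel) \<partial>M)"
      by (intro nn_integral_cong) (simp add: nn_integral_cmult mult.assoc space_F)
    also have "\<dots> = (\<integral>\<^sup>+\<omega>. (\<integral>\<^sup>+y. g (\<omega>, y) * ennreal (normal_density 0 (sqrt (t - s)) y) \<partial>lborel) \<partial>Q)"
      using st by (intro Q[symmetric] nn_conv g) auto
    finally show "(\<integral>\<^sup>+\<omega>. g (\<omega>, W' t \<omega> - W' s \<omega>) \<partial>Q) = \<dots>" .
  qed
  have increment: "gaussian_increment Q (F s) (t - s) (\<lambda>\<omega>. W' t \<omega> - W' s \<omega>)"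
    if st: "0 \<le> s" "s < t" "t \<le> T" for s t
  proof -
    \<comment> \<open>An increment across \<open>u\<close> is cut there into an untouched part and a
      shifted part.\<close>
    consider "t \<le> u" | "u \<le> s" | "s < u" "u < t" by linarith
    then show ?thesis
    proof cases
      case 3
      have [measurable]: "W' s \<in> borel_measurable (F u)" "W' u \<in> borel_measurable (F u)"
        using 3 st u by (auto intro!: W'F)
      have "gaussian_increment Q (F s) ((u - s) + (t - u)) (\<lambda>\<omega>. (W' u \<omega> - W' s \<omega>) + (W' t \<omega> - W' u \<omega>))"
        using 3 st u sets_F_mono[of s u]
        by (intro gaussian_increment_add[OF prob_space_imp_sigma_finite[OF pQ] _ _ _ _ before _ after])
          (auto simp: space_F sub)
      then show ?thesis by simp
    qed (use st before after in auto)
  qed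
  have "brownian_motion Q F T W'"
    unfolding brownian_motion_def
  proof (intro conjI allI impI pQ ballI)
    show "W' t \<in> borel_measurable (F t)" if "t \<in> {0..T}" for t
      using that W'F by auto
    show "AE \<omega> in Q. W' 0 \<omega> = 0"
      unfolding Q_def AE_density[OF \<open>E u T \<in> borel_measurable M\<close>] W'_def using u W by (auto simp: brownian_motion_def)
    have "AE \<omega> in M. continuous_on {0..T} (\<lambda>t. W' t \<omega>)"
    proof -
      have "AE \<omega> in M. continuous_on {0..T} (\<lambda>t. W t \<omega>)"
        using W by (simp add: brownian_motion_def)
      then show ?thesis unfolding W'_def
        by eventually_elim (intro continuous_intros)
    qed
    then show "AE \<omega> in Q. continuous_on {0..T} (\<lambda>t. W' t \<omega>)"
      unfolding Q_def AE_density[OF \<open>E u T \<in> borel_measurable M\<close>] by auto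
    fix s t assume st: "0 \<le> s \<and> s < t \<and> t \<le> T"
    then have *: "space (F s) = space Q" "sets (F s) \<subseteq> sets Q" "gaussian_increment Q (F s) (t - s) (\<lambda>\<omega>. W' t \<omega> - W' s \<omega>)"
      using increment sub by (auto simp: space_F)
    show "distributed Q lborel (\<lambda>\<omega>. W' t \<omega> - W' s \<omega>) (\<lambda>x. ennreal (normal_density 0 (sqrt (t - s)) x))"
      by (rule gaussian_increment_imp_indep(1)[OF pQ *])
    show "prob_space.indep_set Q (sets (F s))
          (sets (vimage_algebra (space Q) (\<lambda>\<omega>. W' t \<omega> - W' s \<omega>) borel))"
      by (rule gaussian_increment_imp_indep(2)[OF pQ *])
  qed
  moreover have "absolutely_continuous M Q"
    unfolding Q_def by (rule absolutely_continuousI_density) simp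
  \<comment> \<open>The density is an exponential and vanishes nowhere, so it creates no new null
    sets.\<close>
  moreover have "absolutely_continuous Q M"
    unfolding absolutely_continuous_def
  proof
    fix A assume "A \<in> null_sets Q"
    then show "A \<in> null_sets M"
      unfolding Q_def null_sets_density_iff[OF \<open>E u T \<in> borel_measurable M\<close>]
      by (auto simp: E_def AE_iff_null_sets)
  qed
  ultimately show ?thesis using sQ by blast
qed

section \<open>Augmentation of the Brownian filtration\<close>

lemma sets_natural_filtration:
  "sets (natural_filtration \<Omega> X t) = sigma_sets \<Omega> {X s -` B \<inter> \<Omega> | s B. 0 \<le> s \<and> s \<le> t \<and> B \<in> sets borel}"
  unfolding natural_filtration_def by (rule sets_measure_of) auto

lemma space_natural_filtration [simp]: "space (natural_filtration \<Omega> X t) = \<Omega>"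
  unfolding natural_filtration_def by (rule space_measure_of) auto

lemma augmented_generator_subset:
  "sets (natural_filtration (space M) X t) \<union> null_sets M \<subseteq> Pow (space M)"
  using sets.sets_into_space[of _ "natural_filtration (space M) X t"] sets.sets_into_space[of _ M]
  by (auto dest: null_setsD2)

lemma sets_augmented_filtration:
  "sets (augmented_filtration M X t) = sigma_sets (space M) (sets (natural_filtration (space M) X t) \<union> null_sets M)"
  unfolding augmented_filtration_def using augmented_generator_subset by (rule sets_measure_of)

lemma filtration_augmented_filtration: "filtration (space M) (augmented_filtration M X)"
proof
  show "space (augmented_filtration M X t) = space M" for t
    unfolding augmented_filtration_def using augmented_generator_subset by (rule space_measure_of)
  fix s t :: real assume "s \<le> t"
  then have "sets (natural_filtration (space M) X s) \<subseteq> sets (natural_filtration (space M) X t)"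
    unfolding sets_natural_filtration by (intro sigma_sets_mono') fastforce
  then show "sets (augmented_filtration M X s) \<subseteq> sets (augmented_filtration M X t)"
    unfolding sets_augmented_filtration by (intro sigma_sets_mono') blast
qed

text \<open>An affine map with nonzero slope is a Borel isomorphism, so preimages can be transported
  both ways.\<close>

lemma natural_filtration_output_process:
  assumes "\<sigma> \<noteq> 0"
  shows "natural_filtration \<Omega> (output_process X0 \<sigma> W) t = natural_filtration \<Omega> W t"
proof -
  have "{output_process X0 \<sigma> W s -` B \<inter> \<Omega> | s B. 0 \<le> s \<and> s \<le> t \<and> B \<in> sets borel}
    = {W s -` B \<inter> \<Omega> | s B. 0 \<le> s \<and> s \<le> t \<and> B \<in> sets borel}" (is "?L = ?R")
  proof (intro equalityI subsetI)
    fix A assume "A \<in> ?L"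
    then obtain s B where "0 \<le> s" "s \<le> t" and B[measurable]: "B \<in> sets borel"
      and A: "A = output_process X0 \<sigma> W s -` B \<inter> \<Omega>" by blast
    have "(\<lambda>x. X0 + \<sigma> * x) -` B \<inter> space borel \<in> sets borel" by measurable
    moreover have "A = W s -` ((\<lambda>x. X0 + \<sigma> * x) -` B \<inter> space borel) \<inter> \<Omega>"
      by (auto simp: A output_process_def)
    ultimately show "A \<in> ?R" using \<open>0 \<le> s\<close> \<open>s \<le> t\<close> by blast
  next
    fix A assume "A \<in> ?R"
    then obtain s B where "0 \<le> s" "s \<le> t" and B[measurable]: "B \<in> sets borel"
      and A: "A = W s -` B \<inter> \<Omega>" by blast
    have "(\<lambda>x. (x - X0) / \<sigma>) -` B \<inter> space borel \<in> sets borel" by measurable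
    moreover have "A = output_process X0 \<sigma> W s -` ((\<lambda>x. (x - X0) / \<sigma>) -` B \<inter> space borel) \<inter> \<Omega>"
      using assms by (auto simp: A output_process_def)
    ultimately show "A \<in> ?L" using \<open>0 \<le> s\<close> \<open>s \<le> t\<close> by blast
  qed
  then show ?thesis unfolding natural_filtration_def by simp
qed

text \<open>Null events are independent of every event, and adding them to \<open>G\<close> keeps
  the family closed under intersection; independence then passes to the generated
  sigma-algebra.\<close>

lemma (in prob_space) indep_set_augmented:
  assumes ind: "indep_set (sets G) (sets H)" and [simp]: "space G = space M" "space H = space M"
  shows "indep_set (sigma_sets (space M) (sets G \<union> null_sets M)) (sets H)"
proof -
  have sub: "sets G \<subseteq> events" "sets H \<subseteq> events"
    using ind unfolding indep_sets2_eq by auto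
  have "indep_set (sigma_sets (space M) (sets G \<union> null_sets M)) (sigma_sets (space M) (sets H))"
  proof (rule indep_set_sigma_sets)
    show "indep_set (sets G \<union> null_sets M) (sets H)"
      unfolding indep_sets2_eq
    proof (intro conjI ballI)
      fix a b assume ab: "a \<in> sets G \<union> null_sets M" "b \<in> sets H"
      show "prob (a \<inter> b) = prob a * prob b"
      proof (cases "a \<in> sets G")
        case True then show ?thesis by (intro indep_setD[OF ind] ab(2))
      next
        case False
        then have "a \<in> null_sets M" using ab by auto
        moreover have "a \<inter> b \<in> null_sets M"
          using ab sub calculation by (intro null_set_Int2) auto
        ultimately show ?thesis by (simp add: measure_eq_0_null_sets)
      qed
    qed (use sub in auto)
    show "Int_stable (sets G \<union> null_sets M)"
    proof (rule Int_stableI)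
      fix a b assume ab: "a \<in> sets G \<union> null_sets M" "b \<in> sets G \<union> null_sets M"
      then have ev: "a \<in> events" "b \<in> events" using sub by auto
      consider "a \<in> sets G" "b \<in> sets G" | "a \<in> null_sets M" | "b \<in> null_sets M" using ab by blast
      then show "a \<inter> b \<in> sets G \<union> null_sets M"
      proof cases
        case 1 then show ?thesis by (intro UnI1 sets.Int)
      next
        case 2 then show ?thesis using ev by (intro UnI2 null_set_Int2)
      next
        case 3 then show ?thesis using ev by (intro UnI2 null_set_Int1)
      qed
    qed
    show "Int_stable (sets H)" by (rule sets.Int_stable)
  qed
  then show ?thesis using sets.sigma_sets_eq[of H] by simp
qed

lemma brownian_motion_augmented:
  fixes M :: "'a measure" and W :: "real \<Rightarrow> 'a \<Rightarrow> real" and T \<sigma> X0 :: real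
  defines "F \<equiv> augmented_filtration M (output_process X0 \<sigma> W)"
  assumes W: "brownian_motion M (natural_filtration (space M) W) T W" and "T > 0" "\<sigma> \<noteq> 0"
  shows "brownian_motion M F T W" "sets (F T) \<subseteq> sets M"
proof -
  interpret prob_space M using W by (simp add: brownian_motion_def)
  let ?N = "natural_filtration (space M) W"
  have F: "sets (F t) = sigma_sets (space M) (sets (?N t) \<union> null_sets M)" for t
    unfolding F_def sets_augmented_filtration natural_filtration_output_process[OF \<open>\<sigma> \<noteq> 0\<close>] ..
  interpret filtration "space M" F unfolding F_def by (rule filtration_augmented_filtration)
  have WN: "W t \<in> borel_measurable (?N t)" if "t \<in> {0..T}" for t
    using W that by (simp add: brownian_motion_def)
  have N_sub: "sets (?N s) \<subseteq> sets M" if "0 \<le> s" "s < T" for s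
    using brownian_motion_gaussian_increment(1)[OF W that(1,2)] by simp
  have [measurable]: "W 0 \<in> borel_measurable M"
    by (rule measurable_from_sub[OF _ N_sub WN[of 0]]) (use \<open>T > 0\<close> in auto)
  \<comment> \<open>The natural filtration is so far known to lie in \<open>M\<close> only before
    \<open>T\<close>, so \<open>W T\<close> is recovered as its increment from time zero plus
    \<open>W 0\<close>.\<close>
  have WM: "W t \<in> borel_measurable M" if "0 \<le> t" "t \<le> T" for t
  proof (cases "t = 0")
    case False
    then have [measurable]: "(\<lambda>\<omega>. W t \<omega> - W 0 \<omega>) \<in> borel_measurable M"
      using that by (intro gaussian_increment_measurable[OF brownian_motion_gaussian_increment(2)[OF W]]) auto
    have "(\<lambda>\<omega>. W t \<omega> - W 0 \<omega> + W 0 \<omega>) \<in> borel_measurable M" by measurable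
    then show ?thesis by simp
  qed simp
  have "sets (?N T) \<subseteq> sets M"
    unfolding sets_natural_filtration
    by (rule sets.sigma_sets_subset) (auto intro!: measurable_sets[OF WM])
  then show FT: "sets (F T) \<subseteq> sets M"
    unfolding F by (intro sets.sigma_sets_subset) auto
  have NF: "sets (?N t) \<subseteq> sets (F t)" for t
    unfolding F by auto
  show "brownian_motion M F T W"
    unfolding brownian_motion_def
  proof (intro conjI ballI allI impI)
    show "W t \<in> borel_measurable (F t)" if "t \<in> {0..T}" for t
      by (rule measurable_from_sub[OF _ NF WN[OF that]]) (simp add: space_F)
    fix s t assume "0 \<le> s \<and> s < t \<and> t \<le> T"
    then have "indep_set (sets (?N s)) (sets (vimage_algebra (space M) (\<lambda>\<omega>. W t \<omega> - W s \<omega>) borel))"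
      and "distributed M lborel (\<lambda>\<omega>. W t \<omega> - W s \<omega>) (\<lambda>x. ennreal (normal_density 0 (sqrt (t - s)) x))"
      using W by (auto simp: brownian_motion_def)
    then show "indep_set (sets (F s)) (sets (vimage_algebra (space M) (\<lambda>\<omega>. W t \<omega> - W s \<omega>) borel))"
      "distributed M lborel (\<lambda>\<omega>. W t \<omega> - W s \<omega>) (\<lambda>x. ennreal (normal_density 0 (sqrt (t - s)) x))"
      unfolding F by (auto intro!: indep_set_augmented)
  qed (use W in \<open>auto simp: brownian_motion_def\<close>)
qed

text \<open>Each induction step adds one kink to the drift of a process that is already Brownian
  under the measure built so far; equivalence of measures is transitive.\<close>

lemma girsanov_step_drift:
  fixes u c :: "nat \<Rightarrow> real"
  assumes W: "brownian_motion M F T W" and F: "filtration (space M) F" "sets (F T) \<subseteq> sets M"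
    and u: "\<And>j. j < n \<Longrightarrow> 0 \<le> u j \<and> u j < T"
  shows "\<exists>Q. sets Q = sets M \<and> absolutely_continuous M Q \<and> absolutely_continuous Q M \<and>
    brownian_motion Q F T (\<lambda>t \<omega>. W t \<omega> - (\<Sum>j<n. c j * max 0 (t - u j)))"
  using u
proof (induction n)
  case 0
  then show ?case using W by (intro exI[of _ M]) (auto simp: absolutely_continuous_def)
next
  case (Suc n)
  then obtain P where P: "sets P = sets M" "absolutely_continuous M P" "absolutely_continuous P M"
    "brownian_motion P F T (\<lambda>t \<omega>. W t \<omega> - (\<Sum>j<n. c j * max 0 (t - u j)))" by force
  have "space P = space M" using P(1) by (rule sets_eq_imp_space_eq)
  then obtain Q where "sets Q = sets P" "absolutely_continuous P Q" "absolutely_continuous Q P"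
    "brownian_motion Q F T (\<lambda>t \<omega>. W t \<omega> - (\<Sum>j<n. c j * max 0 (t - u j)) - c n * max 0 (t - u n))"
    using girsanov_constant_drift[OF P(4), of "u n" "c n"] F Suc.prems[of n] P(1) by auto
  then show ?case using P(1-3)
    by (intro exI[of _ Q]) (auto simp: absolutely_continuous_def algebra_simps)
qed

section \<open>Deterministic efforts and their approximation by step functions\<close>

lemma set_integral_sum:
  fixes f :: "'i \<Rightarrow> 'a \<Rightarrow> real"
  assumes "\<And>j. j \<in> J \<Longrightarrow> set_integrable M A (f j)"
  shows "(LINT x:A|M. \<Sum>j\<in>J. f j x) = (\<Sum>j\<in>J. LINT x:A|M. f j x)"
  using assms unfolding set_lebesgue_integral_def set_integrable_def scaleR_sum_right
  by (rule Bochner_Integration.integral_sum)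

text \<open>The accumulated drift of a step effort is a sum of hinge functions, the form that
  \<open>girsanov_step_drift\<close> delivers.\<close>

lemma set_integral_step:
  fixes u t :: real
  assumes "0 \<le> u"
  shows "set_integrable lborel {0..t} (\<lambda>s. c * indicator {u<..} s)"
    and "(LINT s:{0..t}|lborel. c * indicator {u<..} s) = c * max 0 (t - u)"
proof -
  have eq: "indicator {0..t} s *\<^sub>R (c * indicator {u<..} s) = c * indicator {u<..t} s" for s
    using assms by (auto simp: indicator_def)
  show "set_integrable lborel {0..t} (\<lambda>s. c * indicator {u<..} s)"
    unfolding set_integrable_def eq by (cases "u \<le> t") auto
  show "(LINT s:{0..t}|lborel. c * indicator {u<..} s) = c * max 0 (t - u)"
    unfolding set_lebesgue_integral_def eq by (cases "u \<le> t") (auto simp: max_def)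
qed

text \<open>A sublevel set of time is the slice at zero together with a half-open strip, both of
  them generators. Every deterministic Borel effort inherits predictability from this.\<close>

lemma measurable_fst_predictable_sigma:
  assumes "filtration \<Omega> F"
  shows "fst \<in> borel_measurable (predictable_sigma \<Omega> F T)"
proof -
  interpret filtration \<Omega> F by fact
  let ?G = "{{0} \<times> A | A. A \<in> sets (F 0)} \<union>
        {{s<..t} \<times> A | s t A. 0 \<le> s \<and> s < t \<and> t \<le> T \<and> A \<in> sets (F s)}"
  have top: "\<Omega> \<in> sets (F t)" for t using sets.top[of "F t"] by (simp add: space_F)
  show ?thesis
  \<comment> \<open>For negative \<open>T\<close> the underlying set is empty, and the generators at
    time zero do not lie in it in general.\<close>
  proof (cases "T < 0")
    case True
    then show ?thesis by (auto simp: predictable_sigma_def measurable_def space_measure_of_conv)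
  next
    case False
    have G: "?G \<subseteq> Pow ({0..T} \<times> \<Omega>)"
      using sets.sets_into_space[of _ "F _"] False by (auto simp: space_F)
    let ?P = "predictable_sigma \<Omega> F T"
    have space: "space ?P = {0..T} \<times> \<Omega>" unfolding predictable_sigma_def using G by (rule space_measure_of)
    have gen: "A \<in> ?G \<Longrightarrow> A \<in> sets ?P" for A
      unfolding predictable_sigma_def using G by simp
    have zero: "{0} \<times> \<Omega> \<in> sets ?P"
      by (rule gen, rule UnI1) (use top in blast)
    show ?thesis
    proof (rule borel_measurableI_le)
      fix a :: real
      \<comment> \<open>With \<open>T = 0\<close> there are no strips, and every sublevel set at a
        nonnegative level is the slice at zero.\<close>
      consider "a < 0" | "a = 0 \<or> T = 0 \<and> 0 < a" | "0 < a" "T \<noteq> 0" by linarith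
      then show "{x \<in> space ?P. fst x \<le> a} \<in> sets ?P"
      proof cases
        case 1
        then have *: "{x \<in> space ?P. fst x \<le> a} = {}" by (auto simp: space)
        show ?thesis unfolding * by (rule sets.empty_sets)
      next
        case 2
        then have *: "{x \<in> space ?P. fst x \<le> a} = {0} \<times> \<Omega>" using False by (auto simp: space)
        show ?thesis unfolding * by (rule zero)
      next
        case 3
        have "{0<..min a T} \<times> \<Omega> \<in> sets ?P"
          by (rule gen, rule UnI2, intro CollectI exI[of _ 0] exI[of _ "min a T"] exI[of _ \<Omega>] conjI refl top)
            (use 3 False in auto)
        moreover have "{x \<in> space ?P. fst x \<le> a} = {0} \<times> \<Omega> \<union> {0<..min a T} \<times> \<Omega>"
          using 3 False by (auto simp: space)
        ultimately show ?thesis using zero by (simp only: sets.Un)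
      qed
    qed
  qed
qed

lemma deterministic_effort:
  assumes "filtration (space M) F" and [measurable]: "\<beta> \<in> borel_measurable borel"
    and "\<And>t. t \<in> {0..T} \<Longrightarrow> \<beta> t \<in> {0..abar}"
  shows "(\<lambda>t \<omega>. \<beta> t) \<in> efforts M F T abar"
proof -
  note [measurable] = measurable_fst_predictable_sigma[OF assms(1), of T]
  have "(\<lambda>x. \<beta> (fst x)) \<in> borel_measurable (predictable_sigma (space M) F T)" by measurable
  then show ?thesis using assms(3) by (auto simp: efforts_def split_beta')
qed

text \<open>The value on a cell is that of \<open>\<alpha>\<close> at the left end point, lowered by
  half the tolerance and cut off at zero; uniform continuity controls the rest. Cells are open on
  the left, as in the predictable sigma-algebra, so the step function vanishes at time zero and the
  lower estimate is claimed only for positive times.\<close>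

lemma step_approximation_below:
  fixes \<alpha> :: "real \<Rightarrow> real"
  assumes \<alpha>: "continuous_on {0..T} \<alpha>" "\<And>t. t \<in> {0..T} \<Longrightarrow> \<alpha> t \<in> {0..abar}" and "T > 0" "\<epsilon> > 0"
  obtains n :: nat and u c :: "nat \<Rightarrow> real" where
    "\<And>j. j < n \<Longrightarrow> 0 \<le> u j \<and> u j < T"
    "\<And>t. t \<in> {0..T} \<Longrightarrow> 0 \<le> (\<Sum>j<n. c j * indicator {u j<..} t) \<and> (\<Sum>j<n. c j * indicator {u j<..} t) \<le> \<alpha> t"
    "\<And>t. t \<in> {0<..T} \<Longrightarrow> \<alpha> t - \<epsilon> \<le> (\<Sum>j<n. c j * indicator {u j<..} t)"
proof -
  have "uniformly_continuous_on {0..T} \<alpha>"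
    using \<alpha>(1) by (intro compact_uniformly_continuous) auto
  then obtain d where d: "d > 0" "\<And>x y. x \<in> {0..T} \<Longrightarrow> y \<in> {0..T} \<Longrightarrow> dist y x < d \<Longrightarrow> dist (\<alpha> y) (\<alpha> x) < \<epsilon> / 2"
    unfolding uniformly_continuous_on_def using \<open>\<epsilon> > 0\<close> by (metis half_gt_zero)
  obtain n where n: "T / d < real n" using reals_Archimedean2 by blast
  have n0: "n > 0" using n \<open>T > 0\<close> d(1) by (cases n) (auto simp: divide_less_0_iff dest: order_less_trans)
  define u where "u j = real j * (T / n)" for j :: nat
  define b where "b j = max 0 (\<alpha> (u j) - \<epsilon> / 2)" for j
  \<comment> \<open>Jumps between consecutive cell values, starting from zero, so that the jumps
    active at \<open>t\<close> telescope to the value of its cell.\<close>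
  define c where "c j = b j - (if j = 0 then 0 else b (j - 1))" for j
  let ?\<beta> = "\<lambda>t. \<Sum>j<n. c j * indicator {u j<..} t"
  have telescope: "(\<Sum>j<Suc m. c j) = b m" for m
    by (induction m) (auto simp: c_def)
  have key: "0 \<le> ?\<beta> t \<and> ?\<beta> t \<le> \<alpha> t \<and> \<alpha> t - \<epsilon> \<le> ?\<beta> t" if t: "t \<in> {0<..T}" for t
  proof -
    \<comment> \<open>Index of the cell \<open>{u m<..u (Suc m)}\<close> containing
      \<open>t\<close>; the ceiling assigns a grid point to the cell on its left.\<close>
    define m where "m = nat \<lceil>t * n / T\<rceil> - 1"
    have tn: "0 < t * n / T" "t * n / T \<le> n" using t n0 \<open>T > 0\<close> by (auto simp: field_simps)
    then have ceil: "1 \<le> \<lceil>t * n / T\<rceil>" "\<lceil>t * n / T\<rceil> \<le> int n" by (auto simp: ceiling_le_iff)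
    then have m: "Suc m = nat \<lceil>t * n / T\<rceil>" by (simp add: m_def)
    then have "m < n" using ceil by linarith
    have mi: "int m + 1 = \<lceil>t * n / T\<rceil>" using m ceil by linarith
    have ju: "u j < t \<longleftrightarrow> j \<le> m" for j
    proof -
      have "u j < t \<longleftrightarrow> real_of_int (int j) < t * n / T" using n0 \<open>T > 0\<close> by (simp add: u_def field_simps)
      also have "\<dots> \<longleftrightarrow> int j < \<lceil>t * n / T\<rceil>" by (simp add: less_ceiling_iff)
      also have "\<dots> \<longleftrightarrow> j \<le> m" using mi by linarith
      finally show ?thesis .
    qed
    have "?\<beta> t = (\<Sum>j<n. if j \<le> m then c j else 0)"
      by (intro sum.cong) (auto simp: ju)
    also have "\<dots> = (\<Sum>j<Suc m. c j)"
      using \<open>m < n\<close> by (intro sum.mono_neutral_cong_right) auto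
    finally have eq: "?\<beta> t = b m" unfolding telescope .
    have um: "u m < t" "\<not> u (Suc m) < t" by (simp_all add: ju)
    moreover have "u (Suc m) = u m + T / n" by (simp add: u_def distrib_right add_divide_distrib)
    ultimately have "t \<le> u m + T / n" by linarith
    moreover have "T / n < d" using n d(1) n0 by (simp add: pos_divide_less_eq mult.commute)
    moreover have "0 \<le> u m" using \<open>T > 0\<close> by (simp add: u_def)
    ultimately have "dist (\<alpha> t) (\<alpha> (u m)) < \<epsilon> / 2"
      using t um by (intro d) (auto simp: dist_real_def)
    then have "\<bar>\<alpha> t - \<alpha> (u m)\<bar> < \<epsilon> / 2" by (simp only: dist_real_def)
    moreover have "0 \<le> \<alpha> t" using \<alpha>(2)[of t] t by simp
    ultimately show ?thesis unfolding eq b_def using \<open>\<epsilon> > 0\<close> by (intro conjI; linarith)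
  qed
  show ?thesis
  proof (rule that[of n u c])
    show "0 \<le> u j \<and> u j < T" if "j < n" for j
      using that n0 \<open>T > 0\<close> by (auto simp: u_def field_simps)
    show "0 \<le> ?\<beta> t \<and> ?\<beta> t \<le> \<alpha> t" if "t \<in> {0..T}" for t
    proof (cases "t = 0")
      case True
      moreover have "0 \<le> u j" for j using \<open>T > 0\<close> by (simp add: u_def)
      ultimately have "?\<beta> t = 0" by (intro sum.neutral) (simp add: not_less)
      then show ?thesis using \<alpha>(2)[OF that] by simp
    qed (use key[of t] that in auto)
    show "\<alpha> t - \<epsilon> \<le> ?\<beta> t" if "t \<in> {0<..T}" for t using key[OF that] by simp
  qed
qed

lemma deterministic_effort_approximation:
  fixes \<alpha> :: "real \<Rightarrow> real"
  assumes W: "brownian_motion M F T W" and F: "filtration (space M) F" "sets (F T) \<subseteq> sets M"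
    and \<alpha>: "continuous_on {0..T} \<alpha>" "\<And>t. t \<in> {0..T} \<Longrightarrow> \<alpha> t \<in> {0..abar}"
    and "T > 0" "\<epsilon> > 0" "\<sigma> > 0"
  obtains \<beta> Q where "\<beta> \<in> borel_measurable borel" "(\<lambda>t \<omega>. \<beta> t) \<in> efforts M F T abar"
    "Q \<in> girsanov_measures M F T \<sigma> W (\<lambda>t \<omega>. \<beta> t)"
    "\<And>t. t \<in> {0..T} \<Longrightarrow> 0 \<le> \<beta> t \<and> \<beta> t \<le> \<alpha> t" "\<And>t. t \<in> {0<..T} \<Longrightarrow> \<alpha> t - \<epsilon> \<le> \<beta> t"
proof -
  obtain n :: nat and u c :: "nat \<Rightarrow> real" where
    u: "\<And>j. j < n \<Longrightarrow> 0 \<le> u j \<and> u j < T" and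
    le: "\<And>t. t \<in> {0..T} \<Longrightarrow> 0 \<le> (\<Sum>j<n. c j * indicator {u j<..} t) \<and> (\<Sum>j<n. c j * indicator {u j<..} t) \<le> \<alpha> t" and
    ge: "\<And>t. t \<in> {0<..T} \<Longrightarrow> \<alpha> t - \<epsilon> \<le> (\<Sum>j<n. c j * indicator {u j<..} t)"
    using step_approximation_below[OF \<alpha> \<open>T > 0\<close> \<open>\<epsilon> > 0\<close>] by blast
  let ?\<beta> = "\<lambda>t. \<Sum>j<n. c j * indicator {u j<..} t"
  obtain Q where Q: "sets Q = sets M" "absolutely_continuous M Q" "absolutely_continuous Q M"
    "brownian_motion Q F T (\<lambda>t \<omega>. W t \<omega> - (\<Sum>j<n. c j / \<sigma> * max 0 (t - u j)))"
    using girsanov_step_drift[OF W F, of n u "\<lambda>j. c j / \<sigma>"] u by blast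
  have "(LINT s:{0..t}|lborel. ?\<beta> s / \<sigma>) = (\<Sum>j<n. c j / \<sigma> * max 0 (t - u j))" for t
  proof -
    have "(LINT s:{0..t}|lborel. ?\<beta> s / \<sigma>) = (LINT s:{0..t}|lborel. (\<Sum>j<n. (c j / \<sigma>) * indicator {u j<..} s))"
      by (simp only: sum_divide_distrib times_divide_eq_left)
    also have "\<dots> = (\<Sum>j<n. LINT s:{0..t}|lborel. (c j / \<sigma>) * indicator {u j<..} s)"
      by (rule set_integral_sum, rule set_integral_step(1)) (use u in auto)
    also have "\<dots> = (\<Sum>j<n. c j / \<sigma> * max 0 (t - u j))"
      using u by (intro sum.cong set_integral_step(2)) auto
    finally show ?thesis .
  qed
  then have "Q \<in> girsanov_measures M F T \<sigma> W (\<lambda>t \<omega>. ?\<beta> t)"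
    using Q by (simp add: girsanov_measures_def)
  moreover have meas: "?\<beta> \<in> borel_measurable borel" by measurable
  moreover have "(\<lambda>t \<omega>. ?\<beta> t) \<in> efforts M F T abar"
  proof (rule deterministic_effort[OF F(1) meas])
    show "?\<beta> t \<in> {0..abar}" if "t \<in> {0..T}" for t
      using le[OF that] \<alpha>(2)[OF that] by auto
  qed
  ultimately show ?thesis using le ge by (intro that[of ?\<beta> Q])
qed

section \<open>The dual functions\<close>

text \<open>Young's inequality with the conjugate exponents \<open>\<gamma>\<close> and
  \<open>\<gamma> / (\<gamma> - 1)\<close> yields the tangent bound for the convex power, including
  the tangent at zero.\<close>

lemma powr_above_tangent:
  fixes x y \<gamma> :: real
  assumes "\<gamma> > 1" "x \<ge> 0" "y \<ge> 0"
  shows "y powr \<gamma> + \<gamma> * y powr (\<gamma> - 1) * (x - y) \<le> x powr \<gamma>"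
proof -
  have "x * y powr (\<gamma> - 1) \<le> x powr \<gamma> / \<gamma> + (y powr (\<gamma> - 1)) powr (\<gamma> / (\<gamma> - 1)) / (\<gamma> / (\<gamma> - 1))"
    using assms by (intro Youngs_inequality) (auto simp: field_simps)
  also have "(y powr (\<gamma> - 1)) powr (\<gamma> / (\<gamma> - 1)) = y powr \<gamma>"
    using assms by (simp add: powr_powr)
  finally have "\<gamma> * (x * y powr (\<gamma> - 1)) \<le> \<gamma> * (x powr \<gamma> / \<gamma> + y powr \<gamma> / (\<gamma> / (\<gamma> - 1)))"
    using assms by (intro mult_left_mono) auto
  also have "\<dots> = x powr \<gamma> + (\<gamma> - 1) * y powr \<gamma>"
    using assms by (simp add: field_simps)
  finally have 1: "\<gamma> * (x * y powr (\<gamma> - 1)) \<le> x powr \<gamma> + (\<gamma> - 1) * y powr \<gamma>" .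
  have 2: "y powr (\<gamma> - 1) * y = y powr \<gamma>"
    using powr_add[of y "\<gamma> - 1" 1] assms by (cases "y = 0") (auto simp: powr_one)
  have "\<gamma> * y powr (\<gamma> - 1) * (x - y) = \<gamma> * (x * y powr (\<gamma> - 1)) - \<gamma> * (y powr (\<gamma> - 1) * y)"
    by (simp add: algebra_simps)
  then show ?thesis using 1 2 by (simp add: algebra_simps)
qed

text \<open>Solution of the first-order condition
  \<open>p + (1 + \<kappa>) * \<gamma> * y powr (\<gamma> - 1) = 0\<close>. It is measured in
  utility; the payment that delivers it is its \<open>\<gamma>\<close>-th power.\<close>

definition best_utility :: "real \<Rightarrow> real \<Rightarrow> real \<Rightarrow> real" where
  "best_utility \<gamma> \<kappa> p = (- p / (\<gamma> * (1 + \<kappa>))) powr (1 / (\<gamma> - 1))"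

lemma best_utility_nonneg: "0 \<le> best_utility \<gamma> \<kappa> p"
  by (simp add: best_utility_def)

text \<open>By the first-order condition \<open>- p\<close> is the slope of the cost at this point,
  and a convex cost lies above its tangent there.\<close>

lemma best_utility_optimal:
  assumes "\<gamma> > 1" "\<kappa> \<ge> 0" "p \<le> 0" "y \<ge> 0"
  shows "best_utility \<gamma> \<kappa> p * p + (1 + \<kappa>) * best_utility \<gamma> \<kappa> p powr \<gamma> \<le> y * p + (1 + \<kappa>) * y powr \<gamma>"
proof -
  let ?z = "best_utility \<gamma> \<kappa> p"
  have nn: "0 \<le> - p / (\<gamma> * (1 + \<kappa>))" using assms by (intro divide_nonneg_pos) auto
  have "?z powr (\<gamma> - 1) = - p / (\<gamma> * (1 + \<kappa>))"
    using assms nn by (simp add: best_utility_def powr_powr)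
  moreover have "1 + \<kappa> \<noteq> 0" using assms by simp
  then have "p = - (1 + \<kappa>) * (\<gamma> * (- p / (\<gamma> * (1 + \<kappa>))))"
    using assms(1) by (simp add: divide_simps) (simp add: algebra_simps)
  ultimately have p: "p = - (1 + \<kappa>) * (\<gamma> * ?z powr (\<gamma> - 1))" by simp
  have "(1 + \<kappa>) * (?z powr \<gamma> + \<gamma> * ?z powr (\<gamma> - 1) * (y - ?z)) \<le> (1 + \<kappa>) * y powr \<gamma>"
    using assms by (intro mult_left_mono powr_above_tangent) (auto simp: best_utility_nonneg)
  moreover have "(1 + \<kappa>) * (\<gamma> * ?z powr (\<gamma> - 1) * (y - ?z)) = - p * (y - ?z)"
    by (subst p) (simp add: algebra_simps)
  ultimately show ?thesis by (simp add: algebra_simps)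
qed

lemma F_star_eq:
  assumes "\<gamma> > 1" "\<kappa> \<ge> 0" "p \<le> 0"
  shows "F_star \<gamma> \<kappa> p = best_utility \<gamma> \<kappa> p * p + (1 + \<kappa>) * best_utility \<gamma> \<kappa> p powr \<gamma>"
  unfolding F_star_def F_cost_def
proof (rule cInf_eq_minimum)
  show "best_utility \<gamma> \<kappa> p * p + (1 + \<kappa>) * best_utility \<gamma> \<kappa> p powr \<gamma>
    \<in> (\<lambda>y. y * p - (1 + \<kappa>) * - (y powr \<gamma>)) ` {0..}"
    by (rule image_eqI[of _ _ "best_utility \<gamma> \<kappa> p"]) (auto simp: best_utility_nonneg)
qed (use best_utility_optimal[OF assms] in auto)

lemma F_star_le:
  assumes "\<gamma> > 1" "\<kappa> \<ge> 0" "p \<le> 0" "y \<ge> 0"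
  shows "F_star \<gamma> \<kappa> p \<le> y * p + (1 + \<kappa>) * y powr \<gamma>"
  using best_utility_optimal[OF assms] F_star_eq[OF assms(1-3)] by simp

text \<open>The closed form displays the sign and the degree of homogeneity, the two facts on which
  the comparison of payment dates rests.\<close>

lemma F_star_powr:
  assumes "\<gamma> > 1" "\<kappa> \<ge> 0" "p \<le> 0"
  shows "F_star \<gamma> \<kappa> p = - (1 + \<kappa>) * (\<gamma> - 1) * (- p / (\<gamma> * (1 + \<kappa>))) powr (\<gamma> / (\<gamma> - 1))"
proof -
  let ?z = "best_utility \<gamma> \<kappa> p" and ?q = "- p / (\<gamma> * (1 + \<kappa>))"
  have nn: "0 \<le> ?q" using assms by (intro divide_nonneg_pos) auto
  have zg: "?z powr \<gamma> = ?q powr (\<gamma> / (\<gamma> - 1))"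
    by (simp add: best_utility_def powr_powr)
  have "1 / (\<gamma> - 1) + 1 = \<gamma> / (\<gamma> - 1)" using assms by (simp add: field_simps)
  then have "?z * ?q = ?q powr (\<gamma> / (\<gamma> - 1))"
    using powr_add[of ?q "1 / (\<gamma> - 1)" 1] nn assms by (cases "?q = 0") (auto simp: best_utility_def powr_one)
  moreover have "p = - \<gamma> * (1 + \<kappa>) * ?q" using assms by simp
  then have "?z * p = - \<gamma> * (1 + \<kappa>) * (?z * ?q)" by (metis mult.assoc mult.commute)
  ultimately show ?thesis
    unfolding F_star_eq[OF assms] zg by (simp add: algebra_simps)
qed

lemma F_star_nonpos: "\<gamma> > 1 \<Longrightarrow> \<kappa> \<ge> 0 \<Longrightarrow> p \<le> 0 \<Longrightarrow> F_star \<gamma> \<kappa> p \<le> 0"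
  unfolding F_star_powr by (intro mult_nonpos_nonneg) auto

text \<open>The exponents \<open>- \<rho>\<close> and
  \<open>\<gamma> / (\<gamma> - 1) * (\<rho> - r)\<close> add up. With
  \<open>\<delta> = r / \<rho>\<close> the numerator \<open>\<rho> - r * \<gamma>\<close> is
  \<open>\<rho> * (1 - \<delta> * \<gamma>)\<close>.\<close>

lemma F_star_discounted:
  assumes "\<gamma> > 1" "\<kappa> \<ge> 0" "l \<le> 0"
  shows "exp (- \<rho> * t) * F_star \<gamma> \<kappa> (l * exp ((\<rho> - r) * t)) = exp ((\<rho> - r * \<gamma>) / (\<gamma> - 1) * t) * F_star \<gamma> \<kappa> l"
proof -
  let ?e = "exp ((\<rho> - r) * t)"
  have nn: "l * ?e \<le> 0" using assms by (simp add: mult_nonpos_nonneg)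
  have "(- (l * ?e) / (\<gamma> * (1 + \<kappa>))) powr (\<gamma> / (\<gamma> - 1)) =
     (- l / (\<gamma> * (1 + \<kappa>)) * ?e) powr (\<gamma> / (\<gamma> - 1))" by simp
  also have "\<dots> = (- l / (\<gamma> * (1 + \<kappa>))) powr (\<gamma> / (\<gamma> - 1)) * ?e powr (\<gamma> / (\<gamma> - 1))"
    by (rule powr_mult)
  also have "?e powr (\<gamma> / (\<gamma> - 1)) = exp (\<gamma> / (\<gamma> - 1) * ((\<rho> - r) * t))"
    by (simp add: powr_def)
  finally have 1: "F_star \<gamma> \<kappa> (l * ?e) = F_star \<gamma> \<kappa> l * exp (\<gamma> / (\<gamma> - 1) * ((\<rho> - r) * t))"
    unfolding F_star_powr[OF assms(1,2) nn] F_star_powr[OF assms] by simp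
  have "- \<rho> * t + \<gamma> / (\<gamma> - 1) * ((\<rho> - r) * t) = (\<rho> - r * \<gamma>) / (\<gamma> - 1) * t"
    using assms by (simp add: field_simps)
  then show ?thesis unfolding 1
    by (simp add: mult.commute mult.left_commute exp_add[symmetric])
qed

section \<open>Optimal effort as a function of the multiplier\<close>

locale effort_cost =
  fixes abar :: real and h :: "real \<Rightarrow> real"
  assumes abar: "abar > 0"
    and h_nonneg: "\<And>x. x \<ge> 0 \<Longrightarrow> h x \<ge> 0"
    and h_zero: "h 0 = 0"
    and h_mono: "mono_on {0..} h"
    and h_strictly_convex:
      "\<And>x y t. x \<ge> 0 \<Longrightarrow> y \<ge> 0 \<Longrightarrow> x \<noteq> y \<Longrightarrow> 0 < t \<Longrightarrow> t < 1 \<Longrightarrow>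
         h ((1 - t) * x + t * y) < (1 - t) * h x + t * h y"
    and h_cont: "continuous_on {0..} h"
begin

text \<open>A real choice between maximizers can arise only for \<open>p > 0\<close>; for
  \<open>p \<le> 0\<close> there is exactly one.\<close>

definition best_effort :: "real \<Rightarrow> real" where
  "best_effort p = (SOME a. a \<in> {0..abar} \<and> (\<forall>b\<in>{0..abar}. b + h b * p \<le> a + h a * p))"

lemma h_cont_Icc: "continuous_on {0..abar} h"
  using h_cont by (rule continuous_on_subset) auto

lemma best_effort:
  "best_effort p \<in> {0..abar}" "b \<in> {0..abar} \<Longrightarrow> b + h b * p \<le> best_effort p + h (best_effort p) * p"
proof -
  have "\<exists>a\<in>{0..abar}. \<forall>b\<in>{0..abar}. b + h b * p \<le> a + h a * p"
    using abar by (intro continuous_attains_sup continuous_intros h_cont_Icc) auto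
  then have "\<exists>a. a \<in> {0..abar} \<and> (\<forall>b\<in>{0..abar}. b + h b * p \<le> a + h a * p)" by blast
  from someI_ex[OF this] show "best_effort p \<in> {0..abar}"
    "b \<in> {0..abar} \<Longrightarrow> b + h b * p \<le> best_effort p + h (best_effort p) * p"
    unfolding best_effort_def by auto
qed

text \<open>The midpoint of two distinct maximizers would cost strictly less than their average and
  hence do strictly better.\<close>

lemma best_effort_unique:
  assumes p: "p \<le> 0" and a: "a \<in> {0..abar}" "\<And>b. b \<in> {0..abar} \<Longrightarrow> b + h b * p \<le> a + h a * p"
  shows "a = best_effort p"
proof (rule ccontr)
  assume ne: "a \<noteq> best_effort p"
  let ?b = "best_effort p" and ?m = "(1 - 1/2) * a + 1/2 * best_effort p"
  have eq: "a + h a * p = ?b + h ?b * p"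
    using a(2)[OF best_effort(1)] best_effort(2)[OF a(1)] by (rule antisym[rotated])
  have "h ?m < (1 - 1/2) * h a + 1/2 * h ?b"
    using ne a(1) best_effort(1)[of p] by (intro h_strictly_convex) auto
  \<comment> \<open>For \<open>p = 0\<close> the two equal values are the efforts
    themselves.\<close>
  moreover have "p < 0" using eq ne p by (cases "p = 0") auto
  ultimately have "((1 - 1/2) * h a + 1/2 * h ?b) * p < h ?m * p"
    by (rule mult_strict_right_mono_neg)
  moreover have "?m \<in> {0..abar}" using a(1) best_effort(1)[of p] by auto
  ultimately show False using a(2)[of ?m] eq by (simp add: algebra_simps)
qed

text \<open>A map into a compact set is continuous when its graph is closed. By uniqueness of the
  maximizer the graph is cut out by weak inequalities between continuous functions.\<close>

lemma continuous_best_effort: "continuous_on {..0} best_effort"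
proof (rule continuous_from_closed_graph[of "{0..abar}"])
  let ?ST = "{..0::real} \<times> {0..abar}"
  have graph: "(\<lambda>p. (p, best_effort p)) ` {..0} =
      ?ST \<inter> (\<Inter>b\<in>{0..abar}. {z \<in> ?ST. b + h b * fst z \<le> snd z + h (snd z) * fst z})"
  proof -
    have "z \<in> (\<lambda>p. (p, best_effort p)) ` {..0}"
      if "z \<in> ?ST" "\<And>b. b \<in> {0..abar} \<Longrightarrow> b + h b * fst z \<le> snd z + h (snd z) * fst z" for z
      using best_effort_unique[of "fst z" "snd z"] that by (intro image_eqI[of _ _ "fst z"]) (auto simp: prod_eq_iff)
    then show ?thesis using best_effort by fastforce
  qed
  have "closed (?ST \<inter> (\<Inter>b\<in>{0..abar}. {z \<in> ?ST. b + h b * fst z \<le> snd z + h (snd z) * fst z}))"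
  proof (intro closed_Int closed_INT ballI closed_Times)
    fix b assume "b \<in> {0..abar}"
    have "continuous_on ?ST (\<lambda>z. h (snd z))"
      by (rule continuous_on_compose2[OF h_cont_Icc continuous_on_snd[OF continuous_on_id]]) auto
    then show "closed {z \<in> ?ST. b + h b * fst z \<le> snd z + h (snd z) * fst z}"
      by (intro continuous_on_closed_Collect_le closed_Times continuous_intros) auto
  qed auto
  then show "closed ((\<lambda>p. (p, best_effort p)) ` {..0})"
    unfolding graph .
qed (use best_effort(1) in auto)

lemma G_star_eq: "G_star abar h p = best_effort p + h (best_effort p) * p"
  unfolding G_star_def
  by (rule cSup_eq_maximum) (use best_effort in auto)

lemma G_star_ge: "a \<in> {0..abar} \<Longrightarrow> a + h a * p \<le> G_star abar h p"
  by (simp add: G_star_eq best_effort(2))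

lemma continuous_h_best_effort: "continuous_on {..0} (\<lambda>p. h (best_effort p))"
  by (rule continuous_on_compose2[OF h_cont_Icc continuous_best_effort]) (use best_effort(1) in auto)

lemma continuous_G_star: "continuous_on {..0} (G_star abar h)"
  unfolding G_star_eq[abs_def]
  by (intro continuous_intros continuous_best_effort continuous_h_best_effort)

lemma h_pos:
  assumes "x > 0" shows "h x > 0"
proof -
  have "h ((1 - 1/2) * 0 + 1/2 * x) < (1 - 1/2) * h 0 + 1/2 * h x"
    using assms by (intro h_strictly_convex) auto
  moreover have "h ((1 - 1/2) * 0 + 1/2 * x) \<ge> 0" using assms by (intro h_nonneg) auto
  ultimately show ?thesis using h_zero by simp
qed

text \<open>A convex function lies below its chord, here from the origin to \<open>abar\<close>. The
  slope of the chord later prices small efforts.\<close>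

lemma h_le_linear: "x \<in> {0..abar} \<Longrightarrow> h x \<le> x * (h abar / abar)"
  using h_strictly_convex[of 0 abar "x / abar"] abar h_zero
  by (cases "x = 0 \<or> x = abar") (auto simp: field_simps)

end

section \<open>Weak duality\<close>

lemma set_integral_discount:
  fixes c T :: real
  assumes "0 \<le> T"
  shows "(LINT t:{0..T}|lborel. c * exp (- c * t)) = 1 - exp (- c * T)"
proof -
  have "((\<lambda>t. c * exp (- c * t)) has_integral (- exp (- c * T) - (- exp (- c * 0)))) {0..T}"
    using assms by (intro fundamental_theorem_of_calculus)
      (auto intro!: derivative_eq_intros simp flip: has_real_derivative_iff_has_vector_derivative)
  then have "integral {0..T} (\<lambda>t. c * exp (- c * t)) = 1 - exp (- c * T)"
    by (subst integral_unique) auto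
  moreover have "set_integrable lborel {0..T} (\<lambda>t. c * exp (- c * t))"
    by (intro borel_integrable_atLeastAtMost' continuous_intros)
  ultimately show ?thesis
    by (simp only: set_borel_integral_eq_integral(2))
qed

locale principal_agent = effort_cost abar h for abar :: real and h :: "real \<Rightarrow> real" +
  fixes M :: "'a measure" and W :: "real \<Rightarrow> 'a \<Rightarrow> real"
    and T \<sigma> X0 r \<rho> k \<gamma> :: real and N :: nat
  assumes T: "T > 0" and \<sigma>: "\<sigma> > 0" and r: "r > 0" and \<rho>: "\<rho> > 0" and k: "k > 0"
    and N: "N \<ge> 1" and \<gamma>: "\<gamma> > 1"
    and W: "brownian_motion M (natural_filtration (space M) W) T W"
begin

abbreviation F :: "real \<Rightarrow> 'a measure" where
  "F \<equiv> augmented_filtration M (output_process X0 \<sigma> W)"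

abbreviation first_best :: "real \<Rightarrow> ereal" where
  "first_best R \<equiv> first_best_value M W T \<sigma> X0 r \<rho> k abar N \<gamma> h R"

lemma brownian_F: "brownian_motion M F T W" and sets_F: "t \<le> T \<Longrightarrow> sets (F t) \<subseteq> sets M"
  using brownian_motion_augmented[OF W T, of \<sigma> X0] \<sigma>
    filtration.sets_F_mono[OF filtration_augmented_filtration, of t T M] by auto

sublocale filtration "space M" F by (rule filtration_augmented_filtration)

lemma girsanov_measureD:
  assumes "Q \<in> girsanov_measures M F T \<sigma> W \<alpha>"
  shows "sets Q = sets M" "space Q = space M" "prob_space Q"
  using assms sets_eq_imp_space_eq[of Q M] by (auto simp: girsanov_measures_def brownian_motion_def)

text \<open>The generating predictable rectangles have their event side in some \<open>F s\<close>
  with \<open>s \<le> T\<close>, hence in \<open>M\<close>, so the predictable sigma-algebra is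
  coarser than the trace of the product one. The indicator extends the effort by zero outside
  \<open>{0..T}\<close>.\<close>

lemma effort_measurable:
  assumes "\<alpha> \<in> efforts M F T abar"
  shows "(\<lambda>(t, \<omega>). indicator {0..T} t * \<alpha> t \<omega>) \<in> borel_measurable (lborel \<Otimes>\<^sub>M M)"
proof -
  let ?R = "restrict_space (lborel \<Otimes>\<^sub>M M) ({0..T} \<times> space M)"
  have pred: "(\<lambda>(t, \<omega>). \<alpha> t \<omega>) \<in> borel_measurable (predictable_sigma (space M) F T)"
    using assms by (simp add: efforts_def)
  have Int: "({0..T} \<times> space M) \<inter> space (lborel \<Otimes>\<^sub>M M) = {0..T} \<times> space M"
    by (auto simp: space_pair_measure)
  have sub: "{0..T} \<times> space M \<in> sets (lborel \<Otimes>\<^sub>M M)" by auto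
  let ?G = "{{0} \<times> A | A. A \<in> sets (F 0)} \<union>
        {{s<..t} \<times> A | s t A. 0 \<le> s \<and> s < t \<and> t \<le> T \<and> A \<in> sets (F s)}"
  have G: "?G \<subseteq> {A \<in> sets (lborel \<Otimes>\<^sub>M M). A \<subseteq> {0..T} \<times> space M}"
  proof
    fix B assume B: "B \<in> ?G"
    have "\<exists>I A s. B = I \<times> A \<and> I \<in> sets lborel \<and> I \<subseteq> {0..T} \<and> s \<le> T \<and> A \<in> sets (F s)"
      using B
    proof (elim UnE CollectE exE conjE)
      fix A assume "B = {0} \<times> A" "A \<in> sets (F 0)"
      then show ?thesis using T by (intro exI[of _ "{0}"] exI[of _ A] exI[of _ 0]) auto
    next
      fix s t A assume "B = {s<..t} \<times> A" "0 \<le> s" "s < t" "t \<le> T" "A \<in> sets (F s)"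
      then show ?thesis by (intro exI[of _ "{s<..t}"] exI[of _ A] exI[of _ s]) auto
    qed
    then obtain I A s where B: "B = I \<times> A" "I \<in> sets lborel" "I \<subseteq> {0..T}" "s \<le> T" "A \<in> sets (F s)"
      by blast
    have "A \<in> sets M" using sets_F[OF B(4)] B(5) by auto
    then show "B \<in> {A \<in> sets (lborel \<Otimes>\<^sub>M M). A \<subseteq> {0..T} \<times> space M}"
      using B sets.sets_into_space[of A M] by auto
  qed
  then have Pow: "?G \<subseteq> Pow ({0..T} \<times> space M)" by blast
  have "space (predictable_sigma (space M) F T) = space ?R"
    unfolding predictable_sigma_def using Pow by (subst space_measure_of) (auto simp: space_restrict_space Int)
  moreover have "sets (predictable_sigma (space M) F T) \<subseteq> sets ?R"
  proof -
    have "sigma_sets (space ?R) ?G \<subseteq> sets ?R"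
    proof (intro sets.sigma_sets_subset subsetI)
      fix B assume "B \<in> ?G"
      then have "B \<in> {A \<in> sets (lborel \<Otimes>\<^sub>M M). A \<subseteq> {0..T} \<times> space M}" by (rule subsetD[OF G])
      then show "B \<in> sets ?R" by (simp only: sets_restrict_space_iff Int sub mem_Collect_eq simp_thms)
    qed
    then show ?thesis
      unfolding predictable_sigma_def using Pow by (subst sets_measure_of) (auto simp: space_restrict_space Int)
  qed
  ultimately have "(\<lambda>(t, \<omega>). \<alpha> t \<omega>) \<in> borel_measurable ?R"
    using pred by (rule measurable_from_sub)
  then have "(\<lambda>x. indicator ({0..T} \<times> space M) x *\<^sub>R (case x of (t, \<omega>) \<Rightarrow> \<alpha> t \<omega>)) \<in> borel_measurable (lborel \<Otimes>\<^sub>M M)"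
    by (subst (asm) borel_measurable_restrict_space_iff) (use sub Int in auto)
  then show ?thesis
    by (rule measurable_cong[THEN iffD1, rotated]) (auto simp: indicator_def space_pair_measure)
qed

text \<open>Efforts stay in a compact interval, on which \<open>f\<close> is bounded, and joint
  measurability makes the path integral a bounded random variable. It is used with \<open>f\<close>
  the identity and with \<open>f = h\<close>.\<close>

lemma effort_integrable:
  fixes w f :: "real \<Rightarrow> real"
  assumes \<alpha>: "\<alpha> \<in> efforts M F T abar" and Q: "Q \<in> girsanov_measures M F T \<sigma> W \<alpha>'"
    and w: "continuous_on UNIV w" and f: "continuous_on {0..} f"
  shows "\<And>\<omega>. \<omega> \<in> space M \<Longrightarrow> set_integrable lborel {0..T} (\<lambda>t. w t * f (\<alpha> t \<omega>))" (is "\<And>\<omega>. _ \<Longrightarrow> ?int \<omega>")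
    and "integrable Q (\<lambda>\<omega>. LINT t:{0..T}|lborel. w t * f (\<alpha> t \<omega>))"
proof -
  interpret Q: prob_space Q using girsanov_measureD[OF Q] by simp
  \<comment> \<open>\<open>f\<close> is continuous only on nonnegative arguments; precomposing with
    \<open>max 0\<close> gives a Borel function on the whole line without changing it on
    efforts.\<close>
  let ?f = "\<lambda>x. f (max 0 x)"
  define g where "g t \<omega> = indicator {0..T} t * \<alpha> t \<omega>" for t \<omega>
  have "continuous_on UNIV ?f"
    by (rule continuous_on_compose2[OF f]) (auto intro!: continuous_intros)
  then have [measurable]: "?f \<in> borel_measurable borel" by (rule borel_measurable_continuous_onI)
  have [measurable]: "w \<in> borel_measurable borel" using w by (rule borel_measurable_continuous_onI)
  have g: "(\<lambda>(t, \<omega>). g t \<omega>) \<in> borel_measurable (lborel \<Otimes>\<^sub>M M)"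
    unfolding g_def by (rule effort_measurable[OF \<alpha>])
  then have [measurable]: "(\<lambda>x. g (fst x) (snd x)) \<in> borel_measurable (lborel \<Otimes>\<^sub>M M)"
    by (simp add: split_beta')
  define B where "B t \<omega> = indicator {0..T} t * (w t * ?f (g t \<omega>))" for t \<omega>
  have B_eq: "indicator {0..T} t *\<^sub>R (w t * f (\<alpha> t \<omega>)) = B t \<omega>" if "\<omega> \<in> space M" for t \<omega>
    using \<alpha> that by (auto simp: B_def g_def efforts_def indicator_def max_def)
  have "compact (?f ` {0..abar})"
    by (intro compact_continuous_image compact_Icc continuous_on_subset[OF \<open>continuous_on UNIV ?f\<close>]) auto
  then have "bounded (?f ` {0..abar})" by (rule compact_imp_bounded)
  then obtain b where "\<forall>y\<in>?f ` {0..abar}. norm y \<le> b" unfolding bounded_iff by blast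
  then have b: "\<bar>?f x\<bar> \<le> b" if "x \<in> {0..abar}" for x using that by auto
  have g_range: "t \<in> {0..T} \<Longrightarrow> \<omega> \<in> space M \<Longrightarrow> g t \<omega> \<in> {0..abar}" for t \<omega>
    using \<alpha> by (auto simp: g_def efforts_def)
  have B_bound: "\<bar>B t \<omega>\<bar> \<le> indicator {0..T} t *\<^sub>R (\<bar>w t\<bar> * b)" if "\<omega> \<in> space M" for t \<omega>
    using b[OF g_range[of t \<omega>]] that by (auto simp: B_def indicator_def abs_mult intro!: mult_left_mono)
  have wb: "set_integrable lborel {0..T} (\<lambda>t. \<bar>w t\<bar> * b)"
    by (intro borel_integrable_atLeastAtMost' continuous_intros continuous_on_subset[OF w]) auto
  have [measurable]: "case_prod B \<in> borel_measurable (lborel \<Otimes>\<^sub>M M)"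
    unfolding B_def split_beta' by measurable
  have int: "integrable lborel (\<lambda>t. B t \<omega>)" if "\<omega> \<in> space M" for \<omega>
  proof (rule Bochner_Integration.integrable_bound[OF wb[unfolded set_integrable_def]])
    show "(\<lambda>t. B t \<omega>) \<in> borel_measurable lborel"
      using measurable_compose[OF measurable_Pair2'[OF that] \<open>case_prod B \<in> _\<close>] by simp
    show "AE t in lborel. norm (B t \<omega>) \<le> norm (indicator {0..T} t *\<^sub>R (\<bar>w t\<bar> * b))"
      using order_trans[OF B_bound[OF that] abs_ge_self] by (intro AE_I2) (simp only: real_norm_def)
  qed
  then show "?int \<omega>" if "\<omega> \<in> space M" for \<omega>
    unfolding set_integrable_def using that by (simp only: B_eq)
  have meas: "(\<lambda>\<omega>. LINT t|lborel. B t \<omega>) \<in> borel_measurable M"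
    by (rule lborel.borel_measurable_lebesgue_integral) (use measurable_pair_swap in \<open>simp add: split_beta'\<close>)
  have "integrable Q (\<lambda>\<omega>. LINT t|lborel. B t \<omega>)"
  proof (rule Q.integrable_const_bound)
    show "AE \<omega> in Q. norm (LINT t|lborel. B t \<omega>) \<le> (LINT t:{0..T}|lborel. \<bar>w t\<bar> * b)"
    proof (rule AE_I2)
      fix \<omega> assume "\<omega> \<in> space Q"
      then have "\<omega> \<in> space M" using girsanov_measureD[OF Q] by simp
      then have "\<bar>LINT t|lborel. B t \<omega>\<bar> \<le> (LINT t|lborel. \<bar>B t \<omega>\<bar>)" by simp
      also have "\<dots> \<le> (LINT t:{0..T}|lborel. \<bar>w t\<bar> * b)"
        unfolding set_lebesgue_integral_def
        using int[OF \<open>\<omega> \<in> space M\<close>] wb[unfolded set_integrable_def] B_bound[OF \<open>\<omega> \<in> space M\<close>]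
        by (intro integral_mono) auto
      finally show "norm (LINT t|lborel. B t \<omega>) \<le> (LINT t:{0..T}|lborel. \<bar>w t\<bar> * b)" by simp
    qed
    show "(\<lambda>\<omega>. LINT t|lborel. B t \<omega>) \<in> borel_measurable Q"
      using meas by (simp add: measurable_cong_sets[OF girsanov_measureD(1)[OF Q] refl])
  qed
  moreover have "(LINT t:{0..T}|lborel. w t * f (\<alpha> t \<omega>)) = (LINT t|lborel. B t \<omega>)" if "\<omega> \<in> space Q" for \<omega>
    unfolding set_lebesgue_integral_def using that girsanov_measureD(2)[OF Q] by (simp only: B_eq)
  ultimately show "integrable Q (\<lambda>\<omega>. LINT t:{0..T}|lborel. w t * f (\<alpha> t \<omega>))"
    by (simp cong: Bochner_Integration.integrable_cong)
qed

lemma contractsD: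
  assumes C: "C \<in> contracts M W T \<sigma> X0 abar N \<gamma>" and i: "i \<in> {1..N}"
  shows "pay_time C i \<in> borel_measurable M" "\<And>\<omega>. \<omega> \<in> space M \<Longrightarrow> pay_time C i \<omega> \<in> {0..<T}"
    "bonus C i \<in> borel_measurable M" "\<And>\<omega>. \<omega> \<in> space M \<Longrightarrow> 0 \<le> bonus C i \<omega>"
    "final_pay C \<in> borel_measurable M" "\<And>\<omega>. \<omega> \<in> space M \<Longrightarrow> 0 \<le> final_pay C \<omega>"
proof -
  note C = C[unfolded contracts_def Let_def, simplified]
  have st: "stopping_time F (pay_time C i)" and range: "\<And>\<omega>. \<omega> \<in> space M \<Longrightarrow> pay_time C i \<omega> \<in> {0..<T}"
    and bonus: "bonus C i \<in> borel_measurable (pre_sigma (pay_time C i))"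
    using C i by auto
  have sub: "sets (pre_sigma (pay_time C i)) \<subseteq> sets M"
  proof
    fix A assume A: "A \<in> sets (pre_sigma (pay_time C i))"
    \<comment> \<open>The payment date never exceeds \<open>T\<close>, so every event of its stopped
      sigma-algebra belongs to \<open>F T\<close>.\<close>
    then have "{\<omega> \<in> A. pay_time C i \<omega> \<le> T} = A"
      using sets.sets_into_space[OF A] range by (fastforce simp: space_pre_sigma)
    then show "A \<in> sets M" using sets_pre_sigmaD[OF st A, of T] sets_F[of T] by auto
  qed
  show "pay_time C i \<in> borel_measurable M"
    by (rule measurable_from_sub[OF _ sub measurable_stopping_time_pre_sigma[OF st]]) (simp add: space_pre_sigma)
  show "bonus C i \<in> borel_measurable M"
    by (rule measurable_from_sub[OF _ sub bonus]) (simp add: space_pre_sigma)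
  show "final_pay C \<in> borel_measurable M"
    by (rule measurable_from_sub[of "F T"]) (use C sets_F[of T] in \<open>auto simp: space_F\<close>)
  show "\<And>\<omega>. \<omega> \<in> space M \<Longrightarrow> pay_time C i \<omega> \<in> {0..<T}" by fact
  show "\<And>\<omega>. \<omega> \<in> space M \<Longrightarrow> 0 \<le> bonus C i \<omega>" "\<And>\<omega>. \<omega> \<in> space M \<Longrightarrow> 0 \<le> final_pay C \<omega>"
    using C i by auto
qed

lemma contracts_moments:
  assumes C: "C \<in> contracts M W T \<sigma> X0 abar N \<gamma>" and i: "i \<in> {1..N}"
    and \<alpha>: "\<alpha> \<in> efforts M F T abar" and Q: "Q \<in> girsanov_measures M F T \<sigma> W \<alpha>"
  shows "(\<integral>\<^sup>+ \<omega>. ennreal (\<bar>bonus C i \<omega>\<bar> powr \<gamma>) \<partial>Q) < \<infinity>" "(\<integral>\<^sup>+ \<omega>. ennreal (\<bar>final_pay C \<omega>\<bar> powr \<gamma>) \<partial>Q) < \<infinity>"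
proof -
  let ?m = "\<lambda>i Q. (\<integral>\<^sup>+ \<omega>. ennreal (\<bar>bonus C i \<omega>\<bar> powr \<gamma>) \<partial>Q) + (\<integral>\<^sup>+ \<omega>. ennreal (\<bar>final_pay C \<omega>\<bar> powr \<gamma>) \<partial>Q)"
  let ?s = "\<lambda>i. SUP \<alpha>\<in>efforts M F T abar. SUP Q\<in>girsanov_measures M F T \<sigma> W \<alpha>. ?m i Q"
  have "?m i Q \<le> (SUP Q\<in>girsanov_measures M F T \<sigma> W \<alpha>. ?m i Q)"
    by (rule SUP_upper[OF Q])
  also have "\<dots> \<le> ?s i" by (rule SUP_upper[OF \<alpha>])
  also have "\<dots> \<le> (MAX i\<in>{1..N}. ?s i)" using i by (intro Max_ge) auto
  also have "\<dots> < \<infinity>" using C by (simp add: contracts_def Let_def)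
  finally have "?m i Q < \<infinity>" .
  then show "(\<integral>\<^sup>+ \<omega>. ennreal (\<bar>bonus C i \<omega>\<bar> powr \<gamma>) \<partial>Q) < \<infinity>" "(\<integral>\<^sup>+ \<omega>. ennreal (\<bar>final_pay C \<omega>\<bar> powr \<gamma>) \<partial>Q) < \<infinity>"
    by auto
qed

lemma utility_powr: "0 \<le> x \<Longrightarrow> utility \<gamma> x powr \<gamma> = x"
  using \<gamma> by (simp add: utility_def powr_powr)

text \<open>A power with positive exponent at most \<open>\<gamma>\<close> is dominated by
  \<open>1 + x powr \<gamma>\<close>. The exponents \<open>1\<close> and \<open>1 / \<gamma>\<close>
  cover a payment and its utility; \<open>D\<close> stands for the discount factor at a random
  date.\<close>

lemma integrable_payment:
  assumes Q: "prob_space Q" and [measurable]: "X \<in> borel_measurable Q" "D \<in> borel_measurable Q"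
    and X: "\<And>\<omega>. \<omega> \<in> space Q \<Longrightarrow> 0 \<le> X \<omega>" and D: "\<And>\<omega>. \<omega> \<in> space Q \<Longrightarrow> \<bar>D \<omega>\<bar> \<le> 1"
    and fin: "(\<integral>\<^sup>+ \<omega>. ennreal (\<bar>X \<omega>\<bar> powr \<gamma>) \<partial>Q) < \<infinity>"
  shows "integrable Q (\<lambda>\<omega>. D \<omega> * X \<omega>)" "integrable Q (\<lambda>\<omega>. D \<omega> * utility \<gamma> (X \<omega>))"
proof -
  interpret prob_space Q by fact
  have "integrable Q (\<lambda>\<omega>. \<bar>X \<omega>\<bar> powr \<gamma>)"
    by (rule integrableI_bounded) (use fin in auto)
  then have int: "integrable Q (\<lambda>\<omega>. 1 + \<bar>X \<omega>\<bar> powr \<gamma>)" by auto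
  have bound: "x powr a \<le> 1 + \<bar>x\<bar> powr \<gamma>" if "0 \<le> x" "0 < a" "a \<le> \<gamma>" for x a :: real
  proof (cases "x \<le> 1")
    case True
    then have "x powr a \<le> 1" using that by (simp add: powr_le1)
    then show ?thesis by (simp add: add_increasing2)
  next
    case False
    then have "x powr a \<le> x powr \<gamma>" using that by (intro powr_mono) auto
    then show ?thesis using that by simp
  qed
  have "integrable Q (\<lambda>\<omega>. D \<omega> * X \<omega> powr a)" if "0 < a" "a \<le> \<gamma>" for a
  proof (rule Bochner_Integration.integrable_bound[OF int])
    show "AE \<omega> in Q. norm (D \<omega> * X \<omega> powr a) \<le> norm (1 + \<bar>X \<omega>\<bar> powr \<gamma>)"
    proof (rule AE_I2)
      fix \<omega> assume \<omega>: "\<omega> \<in> space Q"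
      have "\<bar>D \<omega>\<bar> * X \<omega> powr a \<le> 1 * (1 + \<bar>X \<omega>\<bar> powr \<gamma>)"
        using D[OF \<omega>] bound[OF X[OF \<omega>] that] by (intro mult_mono) auto
      then show "norm (D \<omega> * X \<omega> powr a) \<le> norm (1 + \<bar>X \<omega>\<bar> powr \<gamma>)" by (simp add: abs_mult)
    qed
  qed measurable
  from this[of 1] this[of "1 / \<gamma>"] \<gamma> X
  show "integrable Q (\<lambda>\<omega>. D \<omega> * X \<omega>)" "integrable Q (\<lambda>\<omega>. D \<omega> * utility \<gamma> (X \<omega>))"
    by (auto simp: utility_def powr_one less_imp_le divide_le_eq_1 order_trans[of 1 \<gamma> "\<gamma> * \<gamma>"] field_simps
      cong: Bochner_Integration.integrable_cong)
qed

end

lemma continuous_discount: "continuous_on A (\<lambda>t. c * exp (- c * t) :: real)"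
  by (intro continuous_intros)

context principal_agent
begin

text \<open>The dual variable is the utility \<open>y\<close> of the payment, which costs the
  principal \<open>(1 + \<kappa>) * y powr \<gamma>\<close>. Factoring out
  \<open>exp (- \<rho> * t)\<close> turns the agent's discounting into the multiplier
  \<open>l * exp ((\<rho> - r) * t)\<close>.\<close>

lemma payment_dual_bound:
  assumes "0 \<le> \<kappa>" "l \<le> 0" "0 \<le> \<xi>"
  shows "- (exp (- \<rho> * t) * (1 + \<kappa>) * \<xi>) - l * (exp (- r * t) * utility \<gamma> \<xi>) \<le>
    - (exp (- \<rho> * t) * F_star \<gamma> \<kappa> (l * exp ((\<rho> - r) * t)))"
proof -
  let ?y = "utility \<gamma> \<xi>" and ?p = "l * exp ((\<rho> - r) * t)"
  have "F_star \<gamma> \<kappa> ?p \<le> ?y * ?p + (1 + \<kappa>) * ?y powr \<gamma>"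
    using assms \<gamma> by (intro F_star_le) (auto simp: utility_def mult_nonpos_nonneg)
  then have "exp (- \<rho> * t) * F_star \<gamma> \<kappa> ?p \<le> exp (- \<rho> * t) * (?y * ?p + (1 + \<kappa>) * \<xi>)"
    using assms by (intro mult_left_mono) (auto simp: utility_powr)
  also have "\<dots> = exp (- \<rho> * t) * (1 + \<kappa>) * \<xi> + l * ((exp (- \<rho> * t) * exp ((\<rho> - r) * t)) * ?y)"
    by (simp add: algebra_simps)
  also have "exp (- \<rho> * t) * exp ((\<rho> - r) * t) = exp (- r * t)"
    by (simp add: exp_add[symmetric] algebra_simps)
  finally show ?thesis by simp
qed

definition effort_dual :: "real \<Rightarrow> real" where
  "effort_dual l = (LINT t:{0..T}|lborel. \<rho> * exp (- \<rho> * t) * G_star abar h (r / \<rho> * l * exp ((\<rho> - r) * t)))"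

lemma multiplier_nonpos: "l \<le> 0 \<Longrightarrow> r / \<rho> * l * exp ((\<rho> - r) * t) \<le> 0"
  using r \<rho> by (intro mult_nonpos_nonneg mult_nonneg_nonpos) auto

lemma effort_dual_integrable:
  assumes "l \<le> 0"
  shows "set_integrable lborel {0..T} (\<lambda>t. \<rho> * exp (- \<rho> * t) * G_star abar h (r / \<rho> * l * exp ((\<rho> - r) * t)))"
  by (intro borel_integrable_atLeastAtMost' continuous_intros continuous_on_compose2[OF continuous_G_star])
    (use multiplier_nonpos[OF assms] in auto)

lemma effort_dual_integrand:
  "\<rho> * exp (- \<rho> * t) * (a + h a * (r / \<rho> * l * exp ((\<rho> - r) * t))) =
    \<rho> * exp (- \<rho> * t) * a + l * (r * exp (- r * t) * h a)"
proof -
  have "exp (- \<rho> * t) * exp ((\<rho> - r) * t) = exp (- r * t)"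
    by (simp add: exp_add[symmetric] algebra_simps)
  moreover have "\<rho> * exp (- \<rho> * t) * (a + h a * (r / \<rho> * l * exp ((\<rho> - r) * t))) =
    \<rho> * exp (- \<rho> * t) * a + l * (r * (exp (- \<rho> * t) * exp ((\<rho> - r) * t)) * h a)"
    using \<rho> by (simp add: field_simps)
  ultimately show ?thesis by simp
qed

text \<open>\<open>K\<close> bounds the dual payment uniformly over all dates, so the bonus dates
  may be arbitrary and random.\<close>

lemma weak_duality:
  assumes C: "C \<in> contracts M W T \<sigma> X0 abar N \<gamma>" and \<alpha>: "\<alpha> \<in> efforts M F T abar"
    and Q: "Q \<in> girsanov_measures M F T \<sigma> W \<alpha>"
    and part: "utility \<gamma> R \<le> agent_objective T r N \<gamma> h C \<alpha> Q"
    and l: "l \<le> 0"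
    and K: "\<And>t. 0 \<le> t \<Longrightarrow> t \<le> T \<Longrightarrow> - (exp (- \<rho> * t) * F_star \<gamma> k (l * exp ((\<rho> - r) * t))) \<le> K"
  shows "principal_objective T \<rho> k N C \<alpha> Q \<le> l * utility \<gamma> R + real N * K
    - exp (- \<rho> * T) * F_star \<gamma> 0 (l * exp ((\<rho> - r) * T)) + effort_dual l"
proof -
  note QD = girsanov_measureD[OF Q]
  interpret Q: prob_space Q by (rule QD(3))
  have spQ: "\<omega> \<in> space Q \<longleftrightarrow> \<omega> \<in> space M" for \<omega> using QD(2) by simp
  have measQ: "X \<in> borel_measurable M \<Longrightarrow> X \<in> borel_measurable Q" for X :: "'a \<Rightarrow> real"
    using measurable_cong_sets[OF QD(1) refl] by blast
  have N1: "1 \<in> {1..N}" using N by simp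
  note CD = contractsD[OF C] and mom = contracts_moments[OF C _ \<alpha> Q]
  define P where "P \<omega> = - (\<Sum>i=1..N. exp (- \<rho> * pay_time C i \<omega>) * (1 + k) * bonus C i \<omega>)
    - exp (- \<rho> * T) * final_pay C \<omega> + (LINT t:{0..T}|lborel. \<rho> * exp (- \<rho> * t) * \<alpha> t \<omega>)" for \<omega>
  define A where "A \<omega> = (\<Sum>i=1..N. exp (- r * pay_time C i \<omega>) * utility \<gamma> (bonus C i \<omega>))
    + exp (- r * T) * utility \<gamma> (final_pay C \<omega>) - (LINT t:{0..T}|lborel. r * exp (- r * t) * h (\<alpha> t \<omega>))" for \<omega>
  have disc: "\<bar>exp (- c * t)\<bar> \<le> 1" if "0 \<le> t" "0 < c" for c t :: real
    using that by simp
  have wint: "\<omega> \<in> space M \<Longrightarrow> set_integrable lborel {0..T} (\<lambda>t. \<rho> * exp (- \<rho> * t) * \<alpha> t \<omega>)"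
    "integrable Q (\<lambda>\<omega>. LINT t:{0..T}|lborel. \<rho> * exp (- \<rho> * t) * \<alpha> t \<omega>)" for \<omega>
    using effort_integrable[OF \<alpha> Q continuous_discount continuous_on_id] by auto
  have hint: "\<omega> \<in> space M \<Longrightarrow> set_integrable lborel {0..T} (\<lambda>t. r * exp (- r * t) * h (\<alpha> t \<omega>))"
    "integrable Q (\<lambda>\<omega>. LINT t:{0..T}|lborel. r * exp (- r * t) * h (\<alpha> t \<omega>))" for \<omega>
    using effort_integrable[OF \<alpha> Q continuous_discount h_cont] by auto
  have bonus_int: "integrable Q (\<lambda>\<omega>. exp (- c * pay_time C i \<omega>) * bonus C i \<omega>)"
    "integrable Q (\<lambda>\<omega>. exp (- c * pay_time C i \<omega>) * utility \<gamma> (bonus C i \<omega>))" if "i \<in> {1..N}" "0 < c" for i c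
  proof -
    have [measurable]: "pay_time C i \<in> borel_measurable M" using that by (intro CD)
    have "(\<lambda>\<omega>. exp (- (c * pay_time C i \<omega>))) \<in> borel_measurable M" by measurable
    then show "integrable Q (\<lambda>\<omega>. exp (- c * pay_time C i \<omega>) * bonus C i \<omega>)"
      "integrable Q (\<lambda>\<omega>. exp (- c * pay_time C i \<omega>) * utility \<gamma> (bonus C i \<omega>))"
      using that CD(2)[OF that(1)]
      by (auto intro!: integrable_payment[OF QD(3)] measQ CD mom disc simp: spQ simp del: abs_exp_cancel)
  qed
  have final_int: "integrable Q (\<lambda>\<omega>. exp (- c * T) * final_pay C \<omega>)"
    "integrable Q (\<lambda>\<omega>. exp (- c * T) * utility \<gamma> (final_pay C \<omega>))" if "0 < c" for c
    by (rule integrable_payment[OF QD(3)];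
      use that T mom(2)[OF N1] in \<open>auto intro!: measQ CD[OF N1] disc simp: spQ simp del: abs_exp_cancel\<close>)+
  have "integrable Q (\<lambda>\<omega>. exp (- \<rho> * pay_time C i \<omega>) * (1 + k) * bonus C i \<omega>)" if "i \<in> {1..N}" for i
    using integrable_mult_left[OF bonus_int(1)[OF that \<rho>], of "1 + k"] by (simp add: mult_ac)
  then have P_int: "integrable Q P" unfolding P_def[abs_def]
    using wint(2) final_int(1)[OF \<rho>] by (intro Bochner_Integration.integrable_add Bochner_Integration.integrable_diff
      Bochner_Integration.integrable_minus Bochner_Integration.integrable_sum)
  have A_int: "integrable Q A" unfolding A_def[abs_def]
    using hint(2) final_int(2)[OF r] bonus_int(2)[OF _ r] by (intro Bochner_Integration.integrable_add Bochner_Integration.integrable_diff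
      Bochner_Integration.integrable_sum)
  let ?B = "real N * K - exp (- \<rho> * T) * F_star \<gamma> 0 (l * exp ((\<rho> - r) * T)) + effort_dual l"
  \<comment> \<open>The Lagrangian is bounded outcome by outcome, by maximizing over each payment
    and over the effort at each time separately.\<close>
  have pointwise: "P \<omega> - l * A \<omega> \<le> ?B" if \<omega>: "\<omega> \<in> space M" for \<omega>
  proof -
    have 1: "(\<Sum>i=1..N. - (exp (- \<rho> * pay_time C i \<omega>) * (1 + k) * bonus C i \<omega>)
        - l * (exp (- r * pay_time C i \<omega>) * utility \<gamma> (bonus C i \<omega>))) \<le> (\<Sum>i=1..N. K)"
    proof (rule sum_mono)
      fix i assume i: "i \<in> {1..N}"
      show "- (exp (- \<rho> * pay_time C i \<omega>) * (1 + k) * bonus C i \<omega>)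
        - l * (exp (- r * pay_time C i \<omega>) * utility \<gamma> (bonus C i \<omega>)) \<le> K"
        using CD(2)[OF i \<omega>] CD(4)[OF i \<omega>] l k
        by (intro order_trans[OF payment_dual_bound K]) auto
    qed
    have 2: "- (exp (- \<rho> * T) * (1 + 0) * final_pay C \<omega>) - l * (exp (- r * T) * utility \<gamma> (final_pay C \<omega>))
      \<le> - (exp (- \<rho> * T) * F_star \<gamma> 0 (l * exp ((\<rho> - r) * T)))"
      using CD(6)[OF N1 \<omega>] l by (intro payment_dual_bound) auto
    have "(LINT t:{0..T}|lborel. \<rho> * exp (- \<rho> * t) * \<alpha> t \<omega>) + l * (LINT t:{0..T}|lborel. r * exp (- r * t) * h (\<alpha> t \<omega>))
       = (LINT t:{0..T}|lborel. \<rho> * exp (- \<rho> * t) * \<alpha> t \<omega> + l * (r * exp (- r * t) * h (\<alpha> t \<omega>)))"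
      using set_integral_add(2)[OF wint(1)[OF \<omega>] set_integrable_mult_right[OF hint(1)[OF \<omega>]], of l]
      by (simp only: set_integral_mult_right)
    also have "\<dots> \<le> effort_dual l"
      unfolding effort_dual_def
    proof (rule set_integral_mono[OF _ effort_dual_integrable[OF l]])
      show "set_integrable lborel {0..T} (\<lambda>t. \<rho> * exp (- \<rho> * t) * \<alpha> t \<omega> + l * (r * exp (- r * t) * h (\<alpha> t \<omega>)))"
        by (intro set_integral_add(1) set_integrable_mult_right wint(1) hint(1) \<omega>)
      fix t assume t: "t \<in> {0..T}"
      have "\<alpha> t \<omega> \<in> {0..abar}" using \<alpha> t \<omega> by (auto simp: efforts_def)
      then show "\<rho> * exp (- \<rho> * t) * \<alpha> t \<omega> + l * (r * exp (- r * t) * h (\<alpha> t \<omega>)) \<le>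
         \<rho> * exp (- \<rho> * t) * G_star abar h (r / \<rho> * l * exp ((\<rho> - r) * t))"
        unfolding effort_dual_integrand[symmetric] using \<rho> by (intro mult_left_mono G_star_ge) auto
    qed
    finally have 3: "(LINT t:{0..T}|lborel. \<rho> * exp (- \<rho> * t) * \<alpha> t \<omega>)
      + l * (LINT t:{0..T}|lborel. r * exp (- r * t) * h (\<alpha> t \<omega>)) \<le> effort_dual l" .
    have "P \<omega> - l * A \<omega> = (\<Sum>i=1..N. - (exp (- \<rho> * pay_time C i \<omega>) * (1 + k) * bonus C i \<omega>)
        - l * (exp (- r * pay_time C i \<omega>) * utility \<gamma> (bonus C i \<omega>)))
      + (- (exp (- \<rho> * T) * (1 + 0) * final_pay C \<omega>) - l * (exp (- r * T) * utility \<gamma> (final_pay C \<omega>)))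
      + ((LINT t:{0..T}|lborel. \<rho> * exp (- \<rho> * t) * \<alpha> t \<omega>) + l * (LINT t:{0..T}|lborel. r * exp (- r * t) * h (\<alpha> t \<omega>)))"
      by (simp add: P_def A_def sum_subtractf sum_negf sum_distrib_left sum.distrib algebra_simps)
    also have "\<dots> \<le> (\<Sum>i=1..N. K) + - (exp (- \<rho> * T) * F_star \<gamma> 0 (l * exp ((\<rho> - r) * T))) + effort_dual l"
      using 1 2 3 by (intro add_mono)
    finally show ?thesis by simp
  qed
  have "(LINT \<omega>|Q. P \<omega>) - l * (LINT \<omega>|Q. A \<omega>) = (LINT \<omega>|Q. P \<omega> - l * A \<omega>)"
    using P_int A_int by simp
  also have "\<dots> \<le> (LINT \<omega>|Q. ?B)"
    using P_int A_int pointwise by (intro integral_mono) (auto simp: spQ)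
  also have "\<dots> = ?B" by (simp add: Q.prob_space)
  finally have "(LINT \<omega>|Q. P \<omega>) \<le> l * (LINT \<omega>|Q. A \<omega>) + ?B" by simp
  \<comment> \<open>The multiplier is nonpositive and therefore reverses the participation
    inequality.\<close>
  also have "l * (LINT \<omega>|Q. A \<omega>) \<le> l * utility \<gamma> R"
    using part l unfolding agent_objective_def A_def by (intro mult_left_mono_neg)
  finally show ?thesis unfolding principal_objective_def P_def by simp
qed

lemma first_best_le:
  assumes l: "l \<le> 0"
    and K: "\<And>t. 0 \<le> t \<Longrightarrow> t \<le> T \<Longrightarrow> - (exp (- \<rho> * t) * F_star \<gamma> k (l * exp ((\<rho> - r) * t))) \<le> K"
  shows "first_best R \<le> ereal (l * utility \<gamma> R + real N * K
    - exp (- \<rho> * T) * F_star \<gamma> 0 (l * exp ((\<rho> - r) * T)) + effort_dual l)"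
  unfolding first_best_value_def Let_def
  by (rule Sup_least) (use weak_duality[OF _ _ _ _ l K] in auto)

lemma deterministic_contract:
  assumes \<tau>: "\<And>i. i \<in> {1..N} \<Longrightarrow> \<tau> i \<in> {0..<T}" "\<And>i j. i \<in> {1..N} \<Longrightarrow> j \<in> {1..N} \<Longrightarrow> i \<le> j \<Longrightarrow> \<tau> i \<le> \<tau> j"
    and x: "\<And>i. i \<in> {1..N} \<Longrightarrow> 0 \<le> x i" "0 \<le> xT"
  shows "\<lparr>pay_time = \<lambda>i _. \<tau> i, bonus = \<lambda>i _. x i, final_pay = \<lambda>_. xT\<rparr> \<in> contracts M W T \<sigma> X0 abar N \<gamma>"
proof -
  let ?m = "\<lambda>i Q :: 'a measure. (\<integral>\<^sup>+ \<omega>. ennreal (\<bar>x i\<bar> powr \<gamma>) \<partial>Q) + (\<integral>\<^sup>+ \<omega>. ennreal (\<bar>xT\<bar> powr \<gamma>) \<partial>Q)"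
  let ?s = "\<lambda>i. SUP \<alpha>\<in>efforts M F T abar. SUP Q\<in>girsanov_measures M F T \<sigma> W \<alpha>. ?m i Q"
  have "?s i < \<infinity>" for i
  proof -
    have "?s i \<le> ennreal (\<bar>x i\<bar> powr \<gamma>) + ennreal (\<bar>xT\<bar> powr \<gamma>)"
    proof (intro SUP_least)
      fix \<alpha> Q assume "Q \<in> girsanov_measures M F T \<sigma> W \<alpha>"
      then interpret prob_space Q by (rule girsanov_measureD)
      show "?m i Q \<le> ennreal (\<bar>x i\<bar> powr \<gamma>) + ennreal (\<bar>xT\<bar> powr \<gamma>)"
        by (simp add: emeasure_space_1)
    qed
    also have "\<dots> < \<infinity>" by simp
    finally show ?thesis .
  qed
  then have "(MAX i\<in>{1..N}. ?s i) < \<infinity>" using N by (subst Max_less_iff) auto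
  then show ?thesis
    using assms by (simp add: contracts_def Let_def stopping_time_const)
qed

lemma continuous_discounted:
  fixes f :: "real \<Rightarrow> real"
  assumes "continuous_on {0..T} f"
  shows "set_integrable lborel {0..T} (\<lambda>t. c * exp (- c * t) * f t)"
  by (intro borel_integrable_atLeastAtMost' continuous_intros assms)

text \<open>\<open>\<alpha>\<close> is replaced by a slightly smaller step effort, for which a
  measure is available. This costs the principal at most \<open>\<epsilon>\<close> and does not hurt
  the agent.\<close>

lemma first_best_ge_deterministic:
  assumes \<tau>: "\<And>i. i \<in> {1..N} \<Longrightarrow> \<tau> i \<in> {0..<T}" "\<And>i j. i \<in> {1..N} \<Longrightarrow> j \<in> {1..N} \<Longrightarrow> i \<le> j \<Longrightarrow> \<tau> i \<le> \<tau> j"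
    and x: "\<And>i. i \<in> {1..N} \<Longrightarrow> 0 \<le> x i" "0 \<le> xT"
    and \<alpha>: "continuous_on {0..T} \<alpha>" "\<And>t. t \<in> {0..T} \<Longrightarrow> \<alpha> t \<in> {0..abar}"
    and part: "utility \<gamma> R \<le> (\<Sum>i=1..N. exp (- r * \<tau> i) * utility \<gamma> (x i)) + exp (- r * T) * utility \<gamma> xT
      - (LINT t:{0..T}|lborel. r * exp (- r * t) * h (\<alpha> t))"
  shows "ereal (- (\<Sum>i=1..N. exp (- \<rho> * \<tau> i) * (1 + k) * x i) - exp (- \<rho> * T) * xT
      + (LINT t:{0..T}|lborel. \<rho> * exp (- \<rho> * t) * \<alpha> t)) \<le> first_best R" (is "ereal ?P \<le> _")
proof (rule ereal_le_epsilon2)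
  fix \<epsilon> :: real assume \<epsilon>: "0 < \<epsilon>"
  obtain \<beta> Q where [measurable]: "\<beta> \<in> borel_measurable borel" and \<beta>: "(\<lambda>t \<omega>. \<beta> t) \<in> efforts M F T abar"
    and Q: "Q \<in> girsanov_measures M F T \<sigma> W (\<lambda>t \<omega>. \<beta> t)"
    and le: "\<And>t. t \<in> {0..T} \<Longrightarrow> 0 \<le> \<beta> t \<and> \<beta> t \<le> \<alpha> t" and ge: "\<And>t. t \<in> {0<..T} \<Longrightarrow> \<alpha> t - \<epsilon> \<le> \<beta> t"
    using deterministic_effort_approximation[OF brownian_F filtration_axioms sets_F[OF order_refl] \<alpha> T \<epsilon> \<sigma>] by blast
  interpret Q: prob_space Q using girsanov_measureD[OF Q] by simp
  \<comment> \<open>Any outcome serves to read integrability along paths as a statement about the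
    deterministic \<open>\<beta>\<close>.\<close>
  obtain \<omega> where \<omega>: "\<omega> \<in> space M" using Q.not_empty girsanov_measureD(2)[OF Q] by auto
  let ?C = "\<lparr>pay_time = \<lambda>i _. \<tau> i, bonus = \<lambda>i _. x i, final_pay = \<lambda>_. xT\<rparr>"
  have C: "?C \<in> contracts M W T \<sigma> X0 abar N \<gamma>" using \<tau> x by (rule deterministic_contract)
  have \<beta>_int: "set_integrable lborel {0..T} (\<lambda>t. \<rho> * exp (- \<rho> * t) * \<beta> t)"
    by (rule effort_integrable(1)[OF \<beta> Q continuous_discount continuous_on_id \<omega>])
  have h\<beta>_int: "set_integrable lborel {0..T} (\<lambda>t. r * exp (- r * t) * h (\<beta> t))"
    by (rule effort_integrable(1)[OF \<beta> Q continuous_discount h_cont \<omega>])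
  have h\<alpha>_cont: "continuous_on {0..T} (\<lambda>t. h (\<alpha> t))"
    by (rule continuous_on_compose2[OF h_cont \<alpha>(1)]) (use \<alpha>(2) in auto)
  have "(LINT t:{0..T}|lborel. r * exp (- r * t) * h (\<beta> t)) \<le> (LINT t:{0..T}|lborel. r * exp (- r * t) * h (\<alpha> t))"
  proof (rule set_integral_mono[OF h\<beta>_int continuous_discounted[OF h\<alpha>_cont]])
    fix t assume "t \<in> {0..T}"
    then have "h (\<beta> t) \<le> h (\<alpha> t)"
      using le[of t] by (intro mono_onD[OF h_mono]) auto
    then show "r * exp (- r * t) * h (\<beta> t) \<le> r * exp (- r * t) * h (\<alpha> t)"
      using r by (intro mult_left_mono) auto
  qed
  then have "utility \<gamma> R \<le> agent_objective T r N \<gamma> h ?C (\<lambda>t \<omega>. \<beta> t) Q"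
    using part by (simp add: agent_objective_def Q.prob_space)
  then have "ereal (principal_objective T \<rho> k N ?C (\<lambda>t \<omega>. \<beta> t) Q) \<le> first_best R"
    unfolding first_best_value_def Let_def using C \<beta> Q by (intro Sup_upper) blast
  moreover have "?P - \<epsilon> \<le> principal_objective T \<rho> k N ?C (\<lambda>t \<omega>. \<beta> t) Q"
  proof -
    have \<alpha>_int: "set_integrable lborel {0..T} (\<lambda>t. \<rho> * exp (- \<rho> * t) * \<alpha> t)"
      "set_integrable lborel {0..T} (\<lambda>t. \<rho> * exp (- \<rho> * t) * \<epsilon>)"
      by (rule continuous_discounted[OF \<alpha>(1)], rule continuous_discounted[OF continuous_on_const])
    have "(LINT t:{0..T}|lborel. \<rho> * exp (- \<rho> * t) * \<alpha> t) - (LINT t:{0..T}|lborel. \<rho> * exp (- \<rho> * t) * \<epsilon>)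
      = (LINT t:{0..T}|lborel. \<rho> * exp (- \<rho> * t) * \<alpha> t - \<rho> * exp (- \<rho> * t) * \<epsilon>)"
      using set_integral_diff(2)[OF \<alpha>_int] by simp
    also have "\<dots> \<le> (LINT t:{0..T}|lborel. \<rho> * exp (- \<rho> * t) * \<beta> t)"
    proof (rule set_integral_mono_AE[OF set_integral_diff(1)[OF \<alpha>_int] \<beta>_int])
      \<comment> \<open>At time zero the step effort may be far below \<open>\<alpha>\<close>, but a
        single time carries no mass.\<close>
      have "AE t in lborel. t \<noteq> (0::real)" by (rule AE_lborel_singleton)
      then show "AE t\<in>{0..T} in lborel. \<rho> * exp (- \<rho> * t) * \<alpha> t - \<rho> * exp (- \<rho> * t) * \<epsilon> \<le> \<rho> * exp (- \<rho> * t) * \<beta> t"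
      proof eventually_elim
        fix t :: real assume "t \<noteq> 0"
        show "t \<in> {0..T} \<longrightarrow> \<rho> * exp (- \<rho> * t) * \<alpha> t - \<rho> * exp (- \<rho> * t) * \<epsilon> \<le> \<rho> * exp (- \<rho> * t) * \<beta> t"
        proof
          assume "t \<in> {0..T}"
          then have "\<rho> * exp (- \<rho> * t) * (\<alpha> t - \<epsilon>) \<le> \<rho> * exp (- \<rho> * t) * \<beta> t"
            using ge[of t] \<open>t \<noteq> 0\<close> \<rho> by (intro mult_left_mono) auto
          then show "\<rho> * exp (- \<rho> * t) * \<alpha> t - \<rho> * exp (- \<rho> * t) * \<epsilon> \<le> \<rho> * exp (- \<rho> * t) * \<beta> t"
            by (simp add: right_diff_distrib)
        qed
      qed
    qed
    finally have 1: "(LINT t:{0..T}|lborel. \<rho> * exp (- \<rho> * t) * \<alpha> t) - (LINT t:{0..T}|lborel. \<rho> * exp (- \<rho> * t) * \<epsilon>)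
      \<le> (LINT t:{0..T}|lborel. \<rho> * exp (- \<rho> * t) * \<beta> t)" .
    \<comment> \<open>The discount weight has total mass at most one, which keeps the loss within
      \<open>\<epsilon>\<close>.\<close>
    have "(LINT t:{0..T}|lborel. \<rho> * exp (- \<rho> * t) * \<epsilon>) = \<epsilon> * (1 - exp (- \<rho> * T))"
      using set_integral_discount[of T \<rho>] T set_integral_mult_right[where a=\<epsilon> and M=lborel and A="{0..T}" and f="\<lambda>t. \<rho> * exp (- \<rho> * t)"]
      by (simp add: mult.commute)
    also have "\<dots> \<le> \<epsilon> * 1" using \<epsilon> by (intro mult_left_mono) auto
    finally have "(LINT t:{0..T}|lborel. \<rho> * exp (- \<rho> * t) * \<epsilon>) \<le> \<epsilon>" by simp
    then show ?thesis using 1 by (simp add: principal_objective_def Q.prob_space)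
  qed
  ultimately have "ereal (?P - \<epsilon>) \<le> first_best R" using order_trans ereal_less_eq(3) by blast
  then show "ereal ?P \<le> first_best R + ereal \<epsilon>"
    by (cases "first_best R") auto
qed

end

section \<open>Strong duality for deterministic payment dates\<close>

text \<open>This makes terms of higher order negligible against linear ones near zero. In the
  witness the denominator \<open>B + 1\<close> allows \<open>B = 0\<close> and makes the last
  estimate strict.\<close>

lemma ex_small_powr:
  fixes B c q s :: real
  assumes "0 \<le> B" "0 < c" "0 < q" "0 < s"
  shows "\<exists>x>0. x \<le> s \<and> B * x powr q < c"
proof -
  let ?z = "(c / (B + 1)) powr (1 / q)"
  let ?x = "min s ?z"
  have x: "0 < ?x" using assms by (auto simp: min_def)
  have "?x powr q \<le> ?z powr q" using x assms by (intro powr_mono2) auto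
  also have "\<dots> = c / (B + 1)" using assms by (simp add: powr_powr)
  finally have "B * ?x powr q \<le> B * (c / (B + 1))" using assms by (intro mult_left_mono) auto
  also have "\<dots> < c" using assms by (simp add: field_simps)
  finally show ?thesis using x by (intro exI[of _ ?x]) auto
qed

lemma set_integral_discount_mult:
  fixes a c T :: real
  assumes "0 \<le> T"
  shows "(LINT t:{0..T}|lborel. a * (c * exp (- c * t))) = a * (1 - exp (- c * T))"
  by (subst set_integral_mult_right) (simp only: set_integral_discount[OF assms])

text \<open>The base of the power vanishes at \<open>p = 0\<close>, where continuity rests on the
  exponent \<open>1 / (\<gamma> - 1)\<close> being positive.\<close>

lemma continuous_best_utility:
  assumes "\<gamma> > 1" "\<kappa> \<ge> 0"
  shows "continuous_on {..0} (best_utility \<gamma> \<kappa>)"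
proof -
  have "continuous_on {..0} (\<lambda>p. (- p / (\<gamma> * (1 + \<kappa>))) powr (1 / (\<gamma> - 1)))"
  proof (rule continuous_on_powr')
    show "\<forall>p\<in>{..0}. 0 \<le> - p / (\<gamma> * (1 + \<kappa>)) \<and> (- p / (\<gamma> * (1 + \<kappa>)) = 0 \<longrightarrow> 0 < 1 / (\<gamma> - 1))"
    proof
      fix p :: real assume "p \<in> {..0}"
      then have "0 \<le> - p / (\<gamma> * (1 + \<kappa>))" using assms by (intro divide_nonneg_pos) auto
      then show "0 \<le> - p / (\<gamma> * (1 + \<kappa>)) \<and> (- p / (\<gamma> * (1 + \<kappa>)) = 0 \<longrightarrow> 0 < 1 / (\<gamma> - 1))"
        using assms by simp
    qed
  qed (use assms in \<open>auto intro!: continuous_intros\<close>)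
  then show ?thesis by (simp add: best_utility_def[abs_def])
qed

context principal_agent
begin

text \<open>The equality case of \<open>payment_dual_bound\<close>, for the payment
  \<open>y powr \<gamma>\<close>.\<close>

lemma payment_dual_attained:
  fixes \<kappa> l t :: real
  assumes "0 \<le> \<kappa>" "l \<le> 0"
  defines "y \<equiv> best_utility \<gamma> \<kappa> (l * exp ((\<rho> - r) * t))"
  shows "exp (- \<rho> * t) * F_star \<gamma> \<kappa> (l * exp ((\<rho> - r) * t)) =
    l * (exp (- r * t) * y) + exp (- \<rho> * t) * (1 + \<kappa>) * y powr \<gamma>"
proof -
  have "exp (- \<rho> * t) * exp ((\<rho> - r) * t) = exp (- r * t)"
    by (simp add: exp_add[symmetric] algebra_simps)
  moreover have "F_star \<gamma> \<kappa> (l * exp ((\<rho> - r) * t)) = y * (l * exp ((\<rho> - r) * t)) + (1 + \<kappa>) * y powr \<gamma>"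
    unfolding y_def using assms \<gamma> by (intro F_star_eq) (auto simp: mult_nonpos_nonneg)
  then have "exp (- \<rho> * t) * F_star \<gamma> \<kappa> (l * exp ((\<rho> - r) * t)) =
     l * ((exp (- \<rho> * t) * exp ((\<rho> - r) * t)) * y) + exp (- \<rho> * t) * (1 + \<kappa>) * y powr \<gamma>"
    by (simp add: algebra_simps)
  ultimately show ?thesis by simp
qed

lemma utility_best_utility: "utility \<gamma> (best_utility \<gamma> \<kappa> p powr \<gamma>) = best_utility \<gamma> \<kappa> p"
  using \<gamma> by (simp add: utility_def powr_powr best_utility_nonneg)

definition effort_path :: "real \<Rightarrow> real \<Rightarrow> real" where
  "effort_path l t = best_effort (r / \<rho> * l * exp ((\<rho> - r) * t))"

lemma effort_path_range: "effort_path l t \<in> {0..abar}"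
  unfolding effort_path_def by (rule best_effort(1))

lemma continuous_effort_path:
  assumes "l \<le> 0"
  shows "continuous_on {0..T} (effort_path l)"
  unfolding effort_path_def
  by (rule continuous_on_compose2[OF continuous_best_effort])
    (use multiplier_nonpos[OF assms] \<rho> in \<open>auto intro!: continuous_intros\<close>)

lemma continuous_h_effort_path:
  assumes "l \<le> 0"
  shows "continuous_on {0..T} (\<lambda>t. h (effort_path l t))"
  by (rule continuous_on_compose2[OF h_cont_Icc continuous_effort_path[OF assms]])
    (use effort_path_range in auto)

lemma effort_dual_attained:
  assumes "l \<le> 0"
  shows "effort_dual l = (LINT t:{0..T}|lborel. \<rho> * exp (- \<rho> * t) * effort_path l t)
    + l * (LINT t:{0..T}|lborel. r * exp (- r * t) * h (effort_path l t))"
proof -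
  have "effort_dual l = (LINT t:{0..T}|lborel. \<rho> * exp (- \<rho> * t) * effort_path l t + l * (r * exp (- r * t) * h (effort_path l t)))"
    unfolding effort_dual_def G_star_eq effort_path_def effort_dual_integrand ..
  also have "\<dots> = (LINT t:{0..T}|lborel. \<rho> * exp (- \<rho> * t) * effort_path l t)
    + (LINT t:{0..T}|lborel. l * (r * exp (- r * t) * h (effort_path l t)))"
    by (intro set_integral_add(2) set_integrable_mult_right continuous_discounted
      continuous_effort_path continuous_h_effort_path assms)
  finally show ?thesis by (simp only: set_integral_mult_right)
qed

text \<open>Joint continuity in multiplier and time over a compact time interval carries over to the
  gauge integral, which is then identified with the Lebesgue integral.\<close>

lemma continuous_effort_cost:
  "continuous_on {..0} (\<lambda>l. LINT t:{0..T}|lborel. r * exp (- r * t) * h (effort_path l t))"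
proof -
  have "continuous_on ({..0} \<times> cbox 0 T) (\<lambda>z. h (best_effort (r / \<rho> * fst z * exp ((\<rho> - r) * snd z))))"
    by (rule continuous_on_compose2[OF continuous_h_best_effort])
      (use multiplier_nonpos \<rho> in \<open>auto intro!: continuous_intros\<close>)
  then have "continuous_on ({..0} \<times> cbox 0 T) (\<lambda>(l, t). r * exp (- r * t) * h (effort_path l t))"
    unfolding effort_path_def split_beta' by (intro continuous_intros)
  then have "continuous_on {..0} (\<lambda>l. integral (cbox 0 T) (\<lambda>t. r * exp (- r * t) * h (effort_path l t)))"
    by (rule integral_continuous_on_param)
  then show ?thesis
  proof (rule continuous_on_cong[THEN iffD1, rotated -1])
    fix l :: real assume "l \<in> {..0}"
    then have "set_integrable lborel {0..T} (\<lambda>t. r * exp (- r * t) * h (effort_path l t))"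
      by (intro continuous_discounted continuous_h_effort_path) simp
    then show "integral (cbox 0 T) (\<lambda>t. r * exp (- r * t) * h (effort_path l t)) = (LINT t:{0..T}|lborel. r * exp (- r * t) * h (effort_path l t))"
      by (simp only: set_borel_integral_eq_integral(2) interval_cbox)
  qed simp
qed

text \<open>The bound does not depend on \<open>l\<close>, which allows a left end of the multiplier
  interval to be fixed before the effort there is known.\<close>

lemma effort_cost_le:
  assumes "l \<le> 0"
  shows "(LINT t:{0..T}|lborel. r * exp (- r * t) * h (effort_path l t)) \<le> h abar"
proof -
  have "(LINT t:{0..T}|lborel. r * exp (- r * t) * h (effort_path l t)) \<le> (LINT t:{0..T}|lborel. h abar * (r * exp (- r * t)))"
  proof (rule set_integral_mono[OF continuous_discounted[OF continuous_h_effort_path[OF assms]]])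
    show "set_integrable lborel {0..T} (\<lambda>t. h abar * (r * exp (- r * t)))"
      by (intro borel_integrable_atLeastAtMost' continuous_intros)
    fix t
    have "h (effort_path l t) \<le> h abar"
      using effort_path_range[of l t] abar by (intro mono_onD[OF h_mono]) auto
    then have "h (effort_path l t) * (r * exp (- r * t)) \<le> h abar * (r * exp (- r * t))"
      using r by (intro mult_right_mono) auto
    then show "r * exp (- r * t) * h (effort_path l t) \<le> h abar * (r * exp (- r * t))" by (simp only: mult.commute)
  qed
  also have "\<dots> = h abar * (1 - exp (- r * T))"
    using T by (intro set_integral_discount_mult) simp
  also have "\<dots> \<le> h abar * 1"
    using h_nonneg abar by (intro mult_left_mono) auto
  finally show ?thesis by simp
qed

text \<open>Below, \<open>g l\<close> is the surplus that the maximizers of the Lagrangian at \<open>l\<close> leave to the agent. At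
  a zero of \<open>g\<close> they are feasible, and complementary slackness closes the duality gap.\<close>

lemma strong_duality:
  assumes \<tau>: "\<And>i. i \<in> {1..N} \<Longrightarrow> \<tau> i \<in> {0..<T}" "\<And>i j. i \<in> {1..N} \<Longrightarrow> j \<in> {1..N} \<Longrightarrow> i \<le> j \<Longrightarrow> \<tau> i \<le> \<tau> j"
    and R: "R \<ge> 0"
  shows "\<exists>l\<le>0. ereal (l * utility \<gamma> R
      - (\<Sum>i=1..N. exp (- \<rho> * \<tau> i) * F_star \<gamma> k (l * exp ((\<rho> - r) * \<tau> i)))
      - exp (- \<rho> * T) * F_star \<gamma> 0 (l * exp ((\<rho> - r) * T)) + effort_dual l) \<le> first_best R"
proof -
  define y where "y \<kappa> t l = best_utility \<gamma> \<kappa> (l * exp ((\<rho> - r) * t))" for \<kappa> t l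
  define cost where "cost l = (LINT t:{0..T}|lborel. r * exp (- r * t) * h (effort_path l t))" for l
  define g where "g l = (\<Sum>i=1..N. exp (- r * \<tau> i) * y k (\<tau> i) l) + exp (- r * T) * y 0 T l - cost l - utility \<gamma> R" for l
  have y_nonneg: "0 \<le> y \<kappa> t l" for \<kappa> t l by (simp add: y_def best_utility_nonneg)
  have y_cont: "continuous_on {..0} (y \<kappa> t)" if "0 \<le> \<kappa>" for \<kappa> t
    unfolding y_def
    by (rule continuous_on_compose2[OF continuous_best_utility[OF \<gamma> that]])
      (auto intro!: continuous_intros mult_nonpos_nonneg)
  have u_nonneg: "0 \<le> utility \<gamma> R" by (simp add: utility_def)
  have cost_nonneg: "0 \<le> cost l" for l
    unfolding cost_def set_lebesgue_integral_def using r effort_path_range[of l]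
    by (intro integral_nonneg_AE AE_I2) (auto intro!: mult_nonneg_nonneg h_nonneg)
  define c where "c = h abar + utility \<gamma> R"
  have c: "0 \<le> c" using h_nonneg[of abar] abar u_nonneg by (simp add: c_def)
  \<comment> \<open>Chosen so that at \<open>L\<close> the final payment alone gives the agent
    discounted utility \<open>c\<close>, enough for the reservation utility and the largest possible
    effort cost.\<close>
  define L where "L = - (\<gamma> * (c * exp (r * T)) powr (\<gamma> - 1) * exp (- ((\<rho> - r) * T)))"
  have L: "L \<le> 0" using \<gamma> by (simp add: L_def)
  have "- (L * exp ((\<rho> - r) * T)) = \<gamma> * (c * exp (r * T)) powr (\<gamma> - 1) * (exp (- ((\<rho> - r) * T)) * exp ((\<rho> - r) * T))"
    by (simp add: L_def)
  then have "- (L * exp ((\<rho> - r) * T)) / (\<gamma> * (1 + 0)) = (c * exp (r * T)) powr (\<gamma> - 1)"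
    using \<gamma> by (simp add: exp_add[symmetric])
  then have "y 0 T L = c * exp (r * T)"
    unfolding y_def best_utility_def using \<gamma> c by (simp add: powr_powr)
  then have yL: "exp (- r * T) * y 0 T L = c" by (simp add: exp_minus)
  have "\<exists>l. L \<le> l \<and> l \<le> 0 \<and> g l = 0"
  proof (rule IVT2')
    \<comment> \<open>At multiplier zero nothing is paid, while the effort cost is
      nonnegative.\<close>
    show "g 0 \<le> 0"
      using cost_nonneg[of 0] u_nonneg by (simp add: g_def y_def best_utility_def)
    have "0 \<le> (\<Sum>i=1..N. exp (- r * \<tau> i) * y k (\<tau> i) L)"
      by (intro sum_nonneg mult_nonneg_nonneg y_nonneg) auto
    then show "0 \<le> g L"
      using effort_cost_le[OF L] unfolding g_def yL by (simp add: c_def cost_def)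
    have "continuous_on {..0} g" unfolding g_def cost_def
      using k by (intro continuous_intros y_cont continuous_effort_cost) auto
    then show "continuous_on {L..0} g" by (rule continuous_on_subset) auto
  qed (rule L)
  then obtain l where l: "l \<le> 0" "g l = 0" by blast
  define x where "x i = y k (\<tau> i) l powr \<gamma>" for i
  define xT where "xT = y 0 T l powr \<gamma>"
  have u: "utility \<gamma> (x i) = y k (\<tau> i) l" "utility \<gamma> xT = y 0 T l" for i
    unfolding x_def xT_def y_def by (rule utility_best_utility)+
  have "ereal (- (\<Sum>i=1..N. exp (- \<rho> * \<tau> i) * (1 + k) * x i) - exp (- \<rho> * T) * xT
      + (LINT t:{0..T}|lborel. \<rho> * exp (- \<rho> * t) * effort_path l t)) \<le> first_best R"
  proof (rule first_best_ge_deterministic[OF \<tau>])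
    show "utility \<gamma> R \<le> (\<Sum>i = 1..N. exp (- r * \<tau> i) * utility \<gamma> (x i)) + exp (- r * T) * utility \<gamma> xT
      - (LINT t:{0..T}|lborel. r * exp (- r * t) * h (effort_path l t))"
      using l(2) unfolding u g_def cost_def by simp
  qed (use l effort_path_range continuous_effort_path in \<open>auto simp: x_def xT_def\<close>)
  \<comment> \<open>The dual value at \<open>l\<close> and the payoff of its maximizers differ by
    exactly \<open>l * g l\<close>, and \<open>g l\<close> is zero.\<close>
  moreover have "l * utility \<gamma> R
      - (\<Sum>i=1..N. exp (- \<rho> * \<tau> i) * F_star \<gamma> k (l * exp ((\<rho> - r) * \<tau> i)))
      - exp (- \<rho> * T) * F_star \<gamma> 0 (l * exp ((\<rho> - r) * T)) + effort_dual l =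
     - (\<Sum>i=1..N. exp (- \<rho> * \<tau> i) * (1 + k) * x i) - exp (- \<rho> * T) * xT
      + (LINT t:{0..T}|lborel. \<rho> * exp (- \<rho> * t) * effort_path l t) - l * g l"
  proof -
    have 1: "(\<Sum>i=1..N. exp (- \<rho> * \<tau> i) * F_star \<gamma> k (l * exp ((\<rho> - r) * \<tau> i))) =
      l * (\<Sum>i=1..N. exp (- r * \<tau> i) * y k (\<tau> i) l) + (\<Sum>i=1..N. exp (- \<rho> * \<tau> i) * (1 + k) * x i)"
      unfolding sum_distrib_left sum.distrib[symmetric] y_def x_def
      using k l(1) by (intro sum.cong refl payment_dual_attained) auto
    have 2: "exp (- \<rho> * T) * F_star \<gamma> 0 (l * exp ((\<rho> - r) * T)) = l * (exp (- r * T) * y 0 T l) + exp (- \<rho> * T) * xT"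
      using payment_dual_attained[of 0 l T] l(1) by (simp add: y_def xT_def)
    show ?thesis
      unfolding 1 2 effort_dual_attained[OF l(1)] g_def cost_def by (simp add: algebra_simps)
  qed
  ultimately show ?thesis using l by (intro exI[of _ l]) simp
qed

section \<open>Strict bounds for zero reservation utility\<close>

lemma first_best_positive: "0 < first_best 0"
proof -
  \<comment> \<open>A final utility \<open>m * \<epsilon>\<close>, once discounted, covers the chord
    bound for the cost of a constant effort \<open>\<epsilon>\<close>. The payment
    \<open>(m * \<epsilon>) powr \<gamma>\<close> is then of higher order than the gain, which is
    linear in \<open>\<epsilon>\<close>; no bonus is paid.\<close>
  define m where "m = h abar / abar * exp (r * T)"
  have m: "0 < m" using h_pos abar by (simp add: m_def)
  have "0 < 1 - exp (- \<rho> * T)" using \<rho> T by simp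
  then obtain \<epsilon> where \<epsilon>: "0 < \<epsilon>" "\<epsilon> \<le> abar" "exp (- \<rho> * T) * m powr \<gamma> * \<epsilon> powr (\<gamma> - 1) < 1 - exp (- \<rho> * T)"
    using ex_small_powr[of "exp (- \<rho> * T) * m powr \<gamma>" "1 - exp (- \<rho> * T)" "\<gamma> - 1" abar] abar \<gamma> by auto
  have disc: "(LINT t:{0..T}|lborel. c * exp (- c * t) * a) = a * (1 - exp (- c * T))" for c a
    using T set_integral_discount_mult[of T a c] by (simp only: mult.commute less_imp_le)
  have "ereal (- (\<Sum>i=1..N. exp (- \<rho> * 0) * (1 + k) * 0) - exp (- \<rho> * T) * (m * \<epsilon>) powr \<gamma>
      + (LINT t:{0..T}|lborel. \<rho> * exp (- \<rho> * t) * \<epsilon>)) \<le> first_best 0"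
  proof (rule first_best_ge_deterministic)
    have "h \<epsilon> * (1 - exp (- r * T)) \<le> h \<epsilon> * 1"
      using h_nonneg \<epsilon> by (intro mult_left_mono) auto
    also have "\<dots> \<le> \<epsilon> * (h abar / abar)" using h_le_linear[of \<epsilon>] \<epsilon> by simp
    also have "\<dots> = exp (- r * T) * (m * \<epsilon>)" by (simp add: m_def exp_minus)
    finally show "utility \<gamma> 0 \<le> (\<Sum>i = 1..N. exp (- r * 0) * utility \<gamma> 0) + exp (- r * T) * utility \<gamma> ((m * \<epsilon>) powr \<gamma>)
      - (LINT t:{0..T}|lborel. r * exp (- r * t) * h \<epsilon>)"
      using m \<epsilon> \<gamma> unfolding disc by (simp add: utility_def powr_powr)
  qed (use T \<epsilon> in auto)
  then show ?thesis
  proof (rule order_less_le_trans[rotated])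
    have "(m * \<epsilon>) powr \<gamma> = m powr \<gamma> * (\<epsilon> powr (\<gamma> - 1) * \<epsilon>)"
      using powr_add[of \<epsilon> "\<gamma> - 1" 1] \<epsilon> by (simp add: powr_mult)
    then have "exp (- \<rho> * T) * (m * \<epsilon>) powr \<gamma> = (exp (- \<rho> * T) * m powr \<gamma> * \<epsilon> powr (\<gamma> - 1)) * \<epsilon>" by simp
    also have "\<dots> < (1 - exp (- \<rho> * T)) * \<epsilon>" using \<epsilon> by (intro mult_strict_right_mono)
    finally have "0 < - (\<Sum>i=1..N. exp (- \<rho> * 0) * (1 + k) * 0) - exp (- \<rho> * T) * (m * \<epsilon>) powr \<gamma>
      + (LINT t:{0..T}|lborel. \<rho> * exp (- \<rho> * t) * \<epsilon>)"
      unfolding disc by (simp add: mult.commute)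
    then show "0 < ereal (- (\<Sum>i=1..N. exp (- \<rho> * 0) * (1 + k) * 0) - exp (- \<rho> * T) * (m * \<epsilon>) powr \<gamma>
      + (LINT t:{0..T}|lborel. \<rho> * exp (- \<rho> * t) * \<epsilon>))"
      by (simp only: zero_ereal_def less_ereal.simps(1))
  qed
qed

text \<open>At a small multiplier \<open>- s\<close> the dual value of effort falls short of full
  effort by an amount linear in \<open>s\<close>, whereas the dual payments grow only like
  \<open>s powr (\<gamma> / (\<gamma> - 1))\<close>.\<close>

lemma first_best_less: "first_best 0 < ereal (abar * (1 - exp (- \<rho> * T)))"
proof -
  define q where "q = (\<rho> - r * \<gamma>) / (\<gamma> - 1)"
  define H where "H = h (abar / 2)"
  have H: "0 < H" using h_pos abar by (simp add: H_def)
  define d where "d = \<bar>\<rho> - r\<bar> * T"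
  \<comment> \<open>The value of \<open>- F_star\<close> at price \<open>- 1\<close>, that is, the
    coefficient of the homogeneous function.\<close>
  define F0 where "F0 \<kappa> = (1 + \<kappa>) * (\<gamma> - 1) * (1 / (\<gamma> * (1 + \<kappa>))) powr (\<gamma> / (\<gamma> - 1))" for \<kappa>
  have F0: "F_star \<gamma> \<kappa> (- s) = - (F0 \<kappa> * s powr (\<gamma> / (\<gamma> - 1)))" "0 \<le> F0 \<kappa>" if "0 \<le> \<kappa>" "0 \<le> s" for \<kappa> s
    using F_star_powr[OF \<gamma> that(1), of "- s"] that \<gamma> powr_mult[of s "1 / (\<gamma> * (1 + \<kappa>))" "\<gamma> / (\<gamma> - 1)"]
    by (auto simp: F0_def) (simp add: algebra_simps)
  \<comment> \<open>Collects all dual payments. The exponent with \<open>\<bar>q\<bar>\<close>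
    dominates every bonus date for either sign of \<open>q\<close>, so the three regimes are treated
    together.\<close>
  define B where "B = real N * exp (\<bar>q\<bar> * T) * F0 k + exp (q * T) * F0 0"
  define c where "c = (1 - exp (- \<rho> * T)) * (H * (r / \<rho>) * exp (- d))"
  have pos: "0 < 1 - exp (- \<rho> * T)" using \<rho> T by simp
  have B: "0 \<le> B" using F0(2)[of k 0] F0(2)[of 0 0] k by (simp add: B_def)
  have c: "0 < c" unfolding c_def using pos H r \<rho> by (intro mult_pos_pos) auto
  \<comment> \<open>Small enough that at every time the effort \<open>abar / 2\<close> is priced at
    no more than \<open>abar / 2\<close>.\<close>
  define s0 where "s0 = abar / 2 / (H * (r / \<rho>) * exp d)"
  have s0: "0 < s0" unfolding s0_def using H r \<rho> abar by simp
  obtain s where s: "0 < s" "s \<le> s0" "B * s powr (1 / (\<gamma> - 1)) < c"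
    using ex_small_powr[OF B c _ s0, of "1 / (\<gamma> - 1)"] \<gamma> by auto
  define l where "l = - s"
  have l: "l \<le> 0" using s by (simp add: l_def)
  have "first_best 0 \<le> ereal (l * utility \<gamma> 0 + real N * (exp (\<bar>q\<bar> * T) * - F_star \<gamma> k l)
    - exp (- \<rho> * T) * F_star \<gamma> 0 (l * exp ((\<rho> - r) * T)) + effort_dual l)"
  proof (rule first_best_le[OF l])
    fix t assume t: "0 \<le> t" "t \<le> T"
    have "q * t \<le> \<bar>q\<bar> * T"
      using t by (intro order_trans[OF mult_right_mono[OF abs_ge_self] mult_left_mono]) auto
    then have "exp (q * t) * - F_star \<gamma> k l \<le> exp (\<bar>q\<bar> * T) * - F_star \<gamma> k l"
      using F_star_nonpos[OF \<gamma> _ l, of k] k by (intro mult_right_mono) auto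
    then show "- (exp (- \<rho> * t) * F_star \<gamma> k (l * exp ((\<rho> - r) * t))) \<le> exp (\<bar>q\<bar> * T) * - F_star \<gamma> k l"
      using F_star_discounted[OF \<gamma> _ l, of k \<rho> t r] k by (simp add: q_def)
  qed
  also have "l * utility \<gamma> 0 + real N * (exp (\<bar>q\<bar> * T) * - F_star \<gamma> k l)
    - exp (- \<rho> * T) * F_star \<gamma> 0 (l * exp ((\<rho> - r) * T)) + effort_dual l = B * s powr (\<gamma> / (\<gamma> - 1)) + effort_dual l"
  proof -
    have "exp (- \<rho> * T) * F_star \<gamma> 0 (l * exp ((\<rho> - r) * T)) = exp (q * T) * F_star \<gamma> 0 l"
      using F_star_discounted[OF \<gamma> _ l, of 0 \<rho> T r] by (simp add: q_def)
    then show ?thesis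
      using F0(1)[of k s] F0(1)[of 0 s] k s by (simp add: utility_def l_def B_def algebra_simps)
  qed
  also have "ereal (B * s powr (\<gamma> / (\<gamma> - 1)) + effort_dual l) < ereal (abar * (1 - exp (- \<rho> * T)))"
  proof -
    have "effort_dual l \<le> (LINT t:{0..T}|lborel. (abar - H * (r / \<rho>) * exp (- d) * s) * (\<rho> * exp (- \<rho> * t)))"
      unfolding effort_dual_def
    proof (rule set_integral_mono[OF effort_dual_integrable[OF l]])
      show "set_integrable lborel {0..T} (\<lambda>t. (abar - H * (r / \<rho>) * exp (- d) * s) * (\<rho> * exp (- \<rho> * t)))"
        by (intro borel_integrable_atLeastAtMost' continuous_intros)
      fix t assume t: "t \<in> {0..T}"
      let ?p = "r / \<rho> * s * exp ((\<rho> - r) * t)"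
      have "\<bar>(\<rho> - r) * t\<bar> \<le> d" unfolding d_def abs_mult using t by (intro mult_mono) auto
      then have e: "exp (- d) \<le> exp ((\<rho> - r) * t)" "exp ((\<rho> - r) * t) \<le> exp d" by auto
      have lower: "r / \<rho> * s * exp (- d) \<le> ?p" using e r \<rho> s by (intro mult_left_mono) auto
      have "?p \<le> r / \<rho> * s0 * exp d" using e r \<rho> s by (intro mult_mono) auto
      then have "H * ?p \<le> H * (r / \<rho> * s0 * exp d)" using H by (intro mult_left_mono) auto
      also have "\<dots> = abar / 2" unfolding s0_def using H r \<rho> by (simp add: field_simps)
      finally have upper: "H * ?p \<le> abar / 2" .
      let ?a = "best_effort (- ?p)"
      have p0: "0 \<le> ?p" using r \<rho> s by simp
      \<comment> \<open>Either the effort falls short of \<open>abar\<close> by at least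
        \<open>abar / 2\<close>, or it is priced at least as high as the effort
        \<open>abar / 2\<close>; both lose at least \<open>H * ?p\<close>.\<close>
      have "?a - h ?a * ?p \<le> abar - H * ?p"
      proof (cases "?a \<le> abar / 2")
        case True
        moreover have "0 \<le> h ?a * ?p"
          by (rule mult_nonneg_nonneg[OF h_nonneg p0]) (use best_effort(1)[of "- ?p"] in simp)
        ultimately show ?thesis using upper by linarith
      next
        case False
        then have "H \<le> h ?a" unfolding H_def using abar by (intro mono_onD[OF h_mono]) auto
        then have "H * ?p \<le> h ?a * ?p" using p0 by (rule mult_right_mono)
        then show ?thesis using best_effort(1)[of "- ?p"] by auto
      qed
      also have "\<dots> \<le> abar - H * (r / \<rho> * s * exp (- d))"
        using mult_left_mono[OF lower, of H] H by simp
      finally have "G_star abar h (- ?p) \<le> abar - H * (r / \<rho>) * exp (- d) * s"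
        unfolding G_star_eq by (simp add: mult_ac)
      then have "\<rho> * exp (- \<rho> * t) * G_star abar h (- ?p) \<le> \<rho> * exp (- \<rho> * t) * (abar - H * (r / \<rho>) * exp (- d) * s)"
        using \<rho> by (intro mult_left_mono) auto
      then show "\<rho> * exp (- \<rho> * t) * G_star abar h (r / \<rho> * l * exp ((\<rho> - r) * t))
        \<le> (abar - H * (r / \<rho>) * exp (- d) * s) * (\<rho> * exp (- \<rho> * t))"
        by (simp add: l_def mult.commute)
    qed
    also have "\<dots> = (abar - H * (r / \<rho>) * exp (- d) * s) * (1 - exp (- \<rho> * T))"
      using T by (intro set_integral_discount_mult) simp
    also have "\<dots> = abar * (1 - exp (- \<rho> * T)) - c * s"
      by (simp add: c_def algebra_simps)
    finally have 1: "effort_dual l \<le> abar * (1 - exp (- \<rho> * T)) - c * s" .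
    have "1 / (\<gamma> - 1) + 1 = \<gamma> / (\<gamma> - 1)" using \<gamma> by (simp add: field_simps)
    then have "s powr (\<gamma> / (\<gamma> - 1)) = s powr (1 / (\<gamma> - 1)) * s"
      using powr_add[of s "1 / (\<gamma> - 1)" 1] s by simp
    then have "B * s powr (\<gamma> / (\<gamma> - 1)) < c * s"
      using mult_strict_right_mono[OF s(3,1)] by simp
    then show ?thesis using 1 by simp
  qed
  finally show ?thesis .
qed


section \<open>Infima over multipliers and comparison of payment dates\<close>

lemma dual_le_first_best:
  assumes "\<And>i. i \<in> {1..N} \<Longrightarrow> \<tau> i \<in> {0..<T}" "\<And>i j. i \<in> {1..N} \<Longrightarrow> j \<in> {1..N} \<Longrightarrow> i \<le> j \<Longrightarrow> \<tau> i \<le> \<tau> j"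
    and "R \<ge> 0"
  shows "(INF l\<in>{..0}. ereal (l * utility \<gamma> R
      - (\<Sum>i=1..N. exp (- \<rho> * \<tau> i) * F_star \<gamma> k (l * exp ((\<rho> - r) * \<tau> i)))
      - exp (- \<rho> * T) * F_star \<gamma> 0 (l * exp ((\<rho> - r) * T)) + effort_dual l)) \<le> first_best R"
  using strong_duality[OF assms] by (force intro: INF_lower2)

lemma first_best_le_dual:
  assumes K: "\<And>l t. l \<le> 0 \<Longrightarrow> 0 \<le> t \<Longrightarrow> t \<le> T \<Longrightarrow> K l \<le> exp (- \<rho> * t) * F_star \<gamma> k (l * exp ((\<rho> - r) * t))"
  shows "first_best R \<le> (INF l\<in>{..0}. ereal (l * utility \<gamma> R - real N * K l
      - exp (- \<rho> * T) * F_star \<gamma> 0 (l * exp ((\<rho> - r) * T)) + effort_dual l))"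
proof (rule INF_greatest)
  fix l :: real assume "l \<in> {..0}"
  then show "first_best R \<le> ereal (l * utility \<gamma> R - real N * K l
      - exp (- \<rho> * T) * F_star \<gamma> 0 (l * exp ((\<rho> - r) * T)) + effort_dual l)"
    using first_best_le[of l "- K l" R] K[of l] by simp
qed

text \<open>\<open>F_star\<close> is nonpositive, so the larger exponential factor gives the smaller
  value. Keeping \<open>\<rho> - r * \<gamma>\<close> as a factor in the hypothesis treats both
  signs and equality at once.\<close>

lemma F_star_le_discounted:
  assumes "l \<le> 0" "s * (\<rho> - r * \<gamma>) \<ge> t * (\<rho> - r * \<gamma>)"
  shows "exp (- \<rho> * s) * F_star \<gamma> k (l * exp ((\<rho> - r) * s)) \<le> exp (- \<rho> * t) * F_star \<gamma> k (l * exp ((\<rho> - r) * t))"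
proof -
  have "(\<rho> - r * \<gamma>) / (\<gamma> - 1) * t \<le> (\<rho> - r * \<gamma>) / (\<gamma> - 1) * s"
    using assms(2) \<gamma> by (simp add: divide_right_mono mult.commute)
  then show ?thesis
    using F_star_discounted[OF \<gamma> _ assms(1), of k] k F_star_nonpos[OF \<gamma> _ assms(1), of k]
    by (simp only: less_imp_le mult_right_mono_neg exp_le_cancel_iff)
qed

end

theorem theorem1:
  fixes M :: "'a measure" and W :: "real \<Rightarrow> 'a \<Rightarrow> real"
    and T \<sigma> X0 r \<rho> \<delta> k abar \<gamma> R :: real and N :: nat
    and h h' :: "real \<Rightarrow> real" and V :: ereal
  assumes "T > 0" and "\<sigma> > 0" and "r > 0" and "\<rho> > 0" and "\<delta> = r / \<rho>" and "k > 0"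
    and "abar > 0" and "N \<ge> 1" and "\<gamma> > 1" and "R \<ge> 0"
    and h_nonneg: "\<forall>x\<ge>0. h x \<ge> 0"
    and h_zero: "h 0 = 0"
    and h_increasing: "mono_on {0..} h"
    and h_strictly_convex:
      "\<forall>x\<ge>0. \<forall>y\<ge>0. \<forall>t. x \<noteq> y \<and> 0 < t \<and> t < 1 \<longrightarrow>
         h ((1 - t) * x + t * y) < (1 - t) * h x + t * h y"
    and h_C1: "\<forall>x\<ge>0. (h has_real_derivative h' x) (at x within {0..})"
      "continuous_on {0..} h'"
    and brownian: "brownian_motion M (natural_filtration (space M) W) T W"
    and V: "V = first_best_value M W T \<sigma> X0 r \<rho> k abar N \<gamma> h R"
  shows
    "(\<delta> * \<gamma> > 1 \<longrightarrow>
       (\<forall>\<zeta> \<tau>. 0 < \<zeta> \<and> \<zeta> < T / real N \<and> (\<forall>i\<in>{1..N}. \<tau> i = (real i - 1) * \<zeta>) \<longrightarrow>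
         (INF l\<in>{..0}. ereal (l * utility \<gamma> R
             - (\<Sum>i=1..N. exp (- \<rho> * \<tau> i) * F_star \<gamma> k (l * exp ((\<rho> - r) * \<tau> i)))
             - exp (- \<rho> * T) * F_star \<gamma> 0 (l * exp ((\<rho> - r) * T))
             + (LINT t:{0..T}|lborel. \<rho> * exp (- \<rho> * t) * G_star abar h (\<delta> * l * exp ((\<rho> - r) * t)))))
         \<le> V) \<and>
       V \<le> (INF l\<in>{..0}. ereal (l * utility \<gamma> R
             - real N * F_star \<gamma> k l
             - exp (- \<rho> * T) * F_star \<gamma> 0 (l * exp ((\<rho> - r) * T))
             + (LINT t:{0..T}|lborel. \<rho> * exp (- \<rho> * t) * G_star abar h (\<delta> * l * exp ((\<rho> - r) * t)))))) \<and>
     (\<delta> * \<gamma> < 1 \<longrightarrow>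
       (\<forall>\<zeta> \<tau>. 0 < \<zeta> \<and> \<zeta> < T / real N \<and> (\<forall>i\<in>{1..N}. \<tau> i = T - real i * \<zeta>) \<longrightarrow>
         (INF l\<in>{..0}. ereal (l * utility \<gamma> R
             - (\<Sum>i=1..N. exp (- \<rho> * \<tau> i) * F_star \<gamma> k (l * exp ((\<rho> - r) * \<tau> i)))
             - exp (- \<rho> * T) * F_star \<gamma> 0 (l * exp ((\<rho> - r) * T))
             + (LINT t:{0..T}|lborel. \<rho> * exp (- \<rho> * t) * G_star abar h (\<delta> * l * exp ((\<rho> - r) * t)))))
         \<le> V) \<and>
       V \<le> (INF l\<in>{..0}. ereal (l * utility \<gamma> R
             - real N * exp (- \<rho> * T) * F_star \<gamma> k (l * exp ((\<rho> - r) * T))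
             - exp (- \<rho> * T) * F_star \<gamma> 0 (l * exp ((\<rho> - r) * T))
             + (LINT t:{0..T}|lborel. \<rho> * exp (- \<rho> * t) * G_star abar h (\<delta> * l * exp ((\<rho> - r) * t)))))) \<and>
     (\<delta> * \<gamma> = 1 \<longrightarrow>
       V = (INF l\<in>{..0}. ereal (l * utility \<gamma> R
             - real N * exp (- \<rho> * T) * F_star \<gamma> k (l * exp ((\<rho> - r) * T))
             - exp (- \<rho> * T) * F_star \<gamma> 0 (l * exp ((\<rho> - r) * T))
             + (LINT t:{0..T}|lborel. \<rho> * exp (- \<rho> * t) * G_star abar h (\<delta> * l * exp ((\<rho> - r) * t)))))) \<and>
     (R = 0 \<longrightarrow> 0 < V \<and> V < ereal (abar * (1 - exp (- \<rho> * T))))"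
proof -
  have h_cont: "continuous_on {0..} h"
    by (rule DERIV_continuous_on) (use h_C1(1) in auto)
  interpret principal_agent abar h M W T \<sigma> X0 r \<rho> k \<gamma> N
    by unfold_locales (use assms h_cont in blast)+
  have \<delta>: "\<delta> = r / \<rho>" by fact
  have dual: "(LINT t:{0..T}|lborel. \<rho> * exp (- \<rho> * t) * G_star abar h (\<delta> * l * exp ((\<rho> - r) * t))) = effort_dual l" for l
    unfolding effort_dual_def \<delta> ..
  have early: "\<rho> < r * \<gamma> \<longleftrightarrow> \<delta> * \<gamma> > 1" and late: "\<rho> > r * \<gamma> \<longleftrightarrow> \<delta> * \<gamma> < 1"
    unfolding \<delta> using \<open>\<rho> > 0\<close> by (simp_all add: field_simps)
  \<comment> \<open>The dates \<open>T - real i * \<zeta>\<close> decrease in \<open>i\<close>,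
    whereas a contract lists its dates in increasing order; reversing the index leaves the sum
    unchanged.\<close>
  have rev: "(\<Sum>i=1..N. f (N + 1 - i)) = (\<Sum>i=1..N. f i)" for f :: "nat \<Rightarrow> real"
    using sum.atLeastAtMost_rev[of f 1 N] by simp
  \<comment> \<open>\<open>\<zeta> < T / real N\<close> keeps both grids inside
    \<open>{0..<T}\<close>; \<open>i \<ge> 1\<close> keeps the second one away from
    \<open>T\<close>.\<close>
  have grid: "0 \<le> (real i - 1) * \<zeta> \<and> (real i - 1) * \<zeta> < T" "0 < T - real i * \<zeta> \<and> T - real i * \<zeta> < T"
    if "0 < \<zeta>" "\<zeta> < T / real N" "i \<in> {1..N}" for i \<zeta>
  proof -
    have "real i * \<zeta> \<le> real N * \<zeta>" using that by (intro mult_right_mono) auto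
    moreover have "real N * \<zeta> < T" using that \<open>N \<ge> 1\<close> by (simp add: field_simps)
    moreover have "1 * \<zeta> \<le> real i * \<zeta>" using that by (intro mult_right_mono) auto
    moreover have "(real i - 1) * \<zeta> = real i * \<zeta> - \<zeta>" by (simp add: left_diff_distrib)
    ultimately show "0 \<le> (real i - 1) * \<zeta> \<and> (real i - 1) * \<zeta> < T" "0 < T - real i * \<zeta> \<and> T - real i * \<zeta> < T"
      using that(1) by linarith+
  qed
  show ?thesis
    unfolding dual V
  proof (intro conjI impI allI)
    fix \<zeta> \<tau> assume "0 < \<zeta> \<and> \<zeta> < T / real N \<and> (\<forall>i\<in>{1..N}. \<tau> i = (real i - 1) * \<zeta>)"
    then show "(INF l\<in>{..0}. ereal (l * utility \<gamma> R
      - (\<Sum>i=1..N. exp (- \<rho> * \<tau> i) * F_star \<gamma> k (l * exp ((\<rho> - r) * \<tau> i)))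
      - exp (- \<rho> * T) * F_star \<gamma> 0 (l * exp ((\<rho> - r) * T)) + effort_dual l)) \<le> first_best R"
      using grid(1) \<open>R \<ge> 0\<close> by (intro dual_le_first_best) auto
  next
    assume "\<delta> * \<gamma> > 1"
    then have "\<rho> - r * \<gamma> < 0" using early by simp
    \<comment> \<open>The smallest discounted dual value occurs at date zero, where both
      exponentials equal one.\<close>
    then show "first_best R \<le> (INF l\<in>{..0}. ereal (l * utility \<gamma> R - real N * F_star \<gamma> k l
      - exp (- \<rho> * T) * F_star \<gamma> 0 (l * exp ((\<rho> - r) * T)) + effort_dual l))"
      using F_star_le_discounted[where s=0] by (intro first_best_le_dual) (simp add: mult_nonneg_nonpos)
  next
    fix \<zeta> \<tau> assume *: "0 < \<zeta> \<and> \<zeta> < T / real N \<and> (\<forall>i\<in>{1..N}. \<tau> i = T - real i * \<zeta>)"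
    have in_range: "N + 1 - i \<in> {1..N}" if "i \<in> {1..N}" for i using that by auto
    have "\<tau> (N + 1 - i) \<in> {0..<T}" if "i \<in> {1..N}" for i
    proof -
      have "\<tau> (N + 1 - i) = T - real (N + 1 - i) * \<zeta>" using * in_range[OF that] by blast
      then show ?thesis using grid(2)[OF _ _ in_range[OF that], of \<zeta>] * by (simp only: atLeastLessThan_iff less_imp_le)
    qed
    moreover have "\<tau> (N + 1 - i) \<le> \<tau> (N + 1 - j)" if "i \<in> {1..N}" "j \<in> {1..N}" "i \<le> j" for i j
      using * in_range[OF that(1)] in_range[OF that(2)] that(3) by (auto intro!: mult_right_mono)
    ultimately have "(INF l\<in>{..0}. ereal (l * utility \<gamma> R
      - (\<Sum>i=1..N. exp (- \<rho> * \<tau> (N + 1 - i)) * F_star \<gamma> k (l * exp ((\<rho> - r) * \<tau> (N + 1 - i))))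
      - exp (- \<rho> * T) * F_star \<gamma> 0 (l * exp ((\<rho> - r) * T)) + effort_dual l)) \<le> first_best R"
      using \<open>R \<ge> 0\<close> by (intro dual_le_first_best[of "\<lambda>i. \<tau> (N + 1 - i)"])
    then show "(INF l\<in>{..0}. ereal (l * utility \<gamma> R
      - (\<Sum>i=1..N. exp (- \<rho> * \<tau> i) * F_star \<gamma> k (l * exp ((\<rho> - r) * \<tau> i)))
      - exp (- \<rho> * T) * F_star \<gamma> 0 (l * exp ((\<rho> - r) * T)) + effort_dual l)) \<le> first_best R"
      unfolding rev[of "\<lambda>i. exp (- \<rho> * \<tau> i) * F_star \<gamma> k (_ * exp ((\<rho> - r) * \<tau> i))"] .
  next
    assume "\<delta> * \<gamma> < 1"
    then have "\<rho> - r * \<gamma> > 0" using late by simp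
    \<comment> \<open>Here the smallest value occurs at \<open>T\<close>, which enters only as a
      bound because bonuses are paid strictly before \<open>T\<close>.\<close>
    then show "first_best R \<le> (INF l\<in>{..0}. ereal (l * utility \<gamma> R
      - real N * exp (- \<rho> * T) * F_star \<gamma> k (l * exp ((\<rho> - r) * T))
      - exp (- \<rho> * T) * F_star \<gamma> 0 (l * exp ((\<rho> - r) * T)) + effort_dual l))"
      unfolding mult.assoc[of "real N"]
      by (intro first_best_le_dual F_star_le_discounted mult_right_mono) auto
  next
    assume "\<delta> * \<gamma> = 1"
    then have "\<rho> - r * \<gamma> = 0" using early late by linarith
    then have const: "exp (- \<rho> * t) * F_star \<gamma> k (l * exp ((\<rho> - r) * t)) = exp (- \<rho> * T) * F_star \<gamma> k (l * exp ((\<rho> - r) * T))"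
      if "l \<le> 0" for l t
      using that by (intro antisym F_star_le_discounted) auto
    show "first_best R = (INF l\<in>{..0}. ereal (l * utility \<gamma> R
      - real N * exp (- \<rho> * T) * F_star \<gamma> k (l * exp ((\<rho> - r) * T))
      - exp (- \<rho> * T) * F_star \<gamma> 0 (l * exp ((\<rho> - r) * T)) + effort_dual l))" (is "_ = ?dual")
    proof (rule antisym)
      show "first_best R \<le> ?dual"
        unfolding mult.assoc[of "real N"]
        by (rule first_best_le_dual) (rule eq_refl[OF const[symmetric]])
      \<comment> \<open>A bonus at \<open>T\<close> is not admissible, but all dates give the same
        dual value, so every bonus may be moved to date zero.\<close>
      have "?dual = (INF l\<in>{..0}. ereal (l * utility \<gamma> R
        - (\<Sum>i=1..N. exp (- \<rho> * 0) * F_star \<gamma> k (l * exp ((\<rho> - r) * 0)))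
        - exp (- \<rho> * T) * F_star \<gamma> 0 (l * exp ((\<rho> - r) * T)) + effort_dual l))"
      proof (intro INF_cong refl)
        fix l :: real assume "l \<in> {..0}"
        then have "exp (- \<rho> * T) * F_star \<gamma> k (l * exp ((\<rho> - r) * T)) = F_star \<gamma> k l"
          using const[of l 0] by simp
        then show "ereal (l * utility \<gamma> R - real N * exp (- \<rho> * T) * F_star \<gamma> k (l * exp ((\<rho> - r) * T))
            - exp (- \<rho> * T) * F_star \<gamma> 0 (l * exp ((\<rho> - r) * T)) + effort_dual l) =
          ereal (l * utility \<gamma> R - (\<Sum>i=1..N. exp (- \<rho> * 0) * F_star \<gamma> k (l * exp ((\<rho> - r) * 0)))
            - exp (- \<rho> * T) * F_star \<gamma> 0 (l * exp ((\<rho> - r) * T)) + effort_dual l)"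
          by (simp only: mult.assoc[of "real N"]) simp
      qed
      also have "\<dots> \<le> first_best R"
        using \<open>R \<ge> 0\<close> T by (intro dual_le_first_best[of "\<lambda>_. 0"]) auto
      finally show "?dual \<le> first_best R" .
    qed
  next
    assume "R = 0"
    then show "0 < first_best R" "first_best R < ereal (abar * (1 - exp (- \<rho> * T)))"
      using first_best_positive first_best_less by simp_all
  qed
qed

end
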